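(* Let $1\le r<\infty$, let $f\in C([-1,1]^2)$, and let $(p_n)_{n\in\mathbb{N}}$ be a sequence of natural numbers (positive integers) such that $n$ and $n+p_n$ are relatively prime for all $n\in\mathbb{N}$. Then the Lagrange interpolant $\mathcal{L}_{n,p_n}f$ converges for $n\to\infty$ to $f$ in the $L^r$-norm, i.e. $$\lim_{n\to\infty}\|\mathcal{L}_{n,p_n}f-f\|_r = 0.$$
   Context: Norm: $\|f\|_r^r := \frac1{\pi^2}\int_{-1}^1\int_{-1}^1\frac{|f(x,y)|^r}{\sqrt{1-x^2}\sqrt{1-y^2}}\,dx\,dy$. For positive integers $n,p$ with $n$ and $n+p$ relatively prime: $\gamma_{n,p}(t) = (\cos(nt),\cos((n+p)t))$ and $\mathrm{LD}_{n,p} := \{\gamma_{n,p}(\frac{\pi k}{n(n+p)}): k=0,\ldots,n(n+p)\}\subset[-1,1]^2$. With $T_i(x)=\cos(i\arccos x)$ and $\Gamma_{n,p}^L := \{(i,j)\in\mathbb{N}_0^2: \frac{i}{n+p}+\frac jn<1\}\cup\{(0,n)\}$, put $\Pi_{n,p}^{2,L} := \mathrm{span}\{T_i(x)T_j(y): (i,j)\in\Gamma_{n,p}^L\}$. It is known that for $f\in C([-1,1]^2)$ there is a unique polynomial $\mathcal{L}_{n,p}f\in\Pi_{n,p}^{2,L}$ with $\mathcal{L}_{n,p}f(\mathcal{A})=f(\mathcal{A})$ for all $\mathcal{A}\in\mathrm{LD}_{n,p}$; this is the Lagrange interpolant. *)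

theory Defs
  imports "HOL-Analysis.Analysis"
begin

definition lissajous :: "nat \<Rightarrow> nat \<Rightarrow> real \<Rightarrow> real \<times> real" where
  "lissajous n p t = (cos (real n * t), cos (real (n + p) * t))"

definition LD :: "nat \<Rightarrow> nat \<Rightarrow> (real \<times> real) set" where
  "LD n p = {lissajous n p (pi * real k / real (n * (n + p))) | k. k \<le> n * (n + p)}"

(* Meaningful for x in [-1,1] only, since arccos is unspecified elsewhere. *)
definition cheb :: "nat \<Rightarrow> real \<Rightarrow> real" where
  "cheb i x = cos (real i * arccos x)"

definition Gamma_L :: "nat \<Rightarrow> nat \<Rightarrow> (nat \<times> nat) set" where
  "Gamma_L n p = {(i, j). real i / real (n + p) + real j / real n < 1} \<union> {(0, n)}"

(* The real span of the products T_i(x) T_j(y) over the index set, which is finite for n >= 1.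
   Its elements are polynomials on [-1,1] x [-1,1]; the node sets lie in this square and
   the norm below only sees the values there. The values outside it are unspecified,
   but they are still determined by the coefficients c. *)
definition Pi_L :: "nat \<Rightarrow> nat \<Rightarrow> (real \<times> real \<Rightarrow> real) set" where
  "Pi_L n p =
    {\<lambda>(x, y). \<Sum>(i, j)\<in>Gamma_L n p. c (i, j) * (cheb i x * cheb j y) | c. True}"

definition lagrange_interpolant ::
    "nat \<Rightarrow> nat \<Rightarrow> (real \<times> real \<Rightarrow> real) \<Rightarrow> real \<times> real \<Rightarrow> real" where
  "lagrange_interpolant n p f = (THE P. P \<in> Pi_L n p \<and> (\<forall>A\<in>LD n p. P A = f A))"

(* On the boundary of the square the weight takes the value 0 (division by zero);
   this is a null set. *)
definition cheb_norm :: "real \<Rightarrow> (real \<times> real \<Rightarrow> real) \<Rightarrow> real" where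
  "cheb_norm r f =
    (1 / pi\<^sup>2 * (LBINT y:{-1..1}. LBINT x:{-1..1}.
        \<bar>f (x, y)\<bar> powr r / (sqrt (1 - x\<^sup>2) * sqrt (1 - y\<^sup>2)))) powr (1 / r)"

end

(* Put A = n + p and B = n. On the torus the nodes (pi k / A, pi k / B), k < 2 A B, form a subgroup
   whose dual lattice is generated by (A, B) and (A, -B). Since A and B are coprime, the open
   diamond |a| / A + |b| / B < 1 together with one of its vertices represents every residue class
   modulo the dual lattice exactly once. This gives existence and uniqueness of the interpolant,
   and identifies its Fourier coefficients with the discrete ones.

   Everything else rests on the stability estimate ||P||_q <= C max_LD |P| for P in Pi_L, with
   q a power of 2 and C independent of n and p. Convolving the nodal values with a de la Vallee
   Poussin kernel gives a trigonometric polynomial that is bounded by 9 max_LD |P| and has the same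
   Fourier coefficients as P on the diamond. The diamond is an intersection of four half planes,
   and the projection to a half plane is bounded on L^q by Cotlar's proof of M. Riesz' theorem,
   with a constant not depending on the half plane. Torus integrals are replaced by averages over
   a fine grid, which are exact for trigonometric polynomials.

   If Q is a polynomial that is uniformly close to f, then for large n the interpolant of Q is Q
   itself, and the estimate applies to P = L f - Q, which equals f - Q on the nodes. *)

theory Submission
  imports Defs
begin

section \<open>Trigonometric polynomials on the torus\<close>

text \<open>The maximum norm is out of reach for this argument: a sharp cut-off to a half plane of
  frequencies is bounded on L^q for 1 < q < \<infinity>, but not uniformly. The second obstacle is
  that \<open>p n\<close> is arbitrary. The diamond can be arbitrarily elongated and its sides can
  have any rational slope, so a constant that depends on the slope would be useless. Cotlar's
  argument avoids this because it only uses how the two sides of a line behave when frequencies are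
  added. It starts from orthogonality at exponent 2 and doubles the exponent, whence the powers of
  2. A general r is reached by a pointwise comparison at scale \<epsilon>, where
  \<open>\<epsilon> powr (r - q) * x ^ q + \<epsilon> powr r\<close> dominates
  \<open>x powr r\<close>; for even q and x = |P| this majorant is again a polynomial, so its
  weighted integral is a grid average. The grid size \<open>M\<close> has nothing to do with the
  nodes: it only has to be large compared with the degrees, and it cancels at the end. The constant
  9 is a factor 3 for each coordinate, since the kernel sums over a box with both sides
  tripled.\<close>

definition character :: "int \<times> int \<Rightarrow> real \<times> real \<Rightarrow> complex" where
  "character w z = cis (of_int (fst w) * fst z + of_int (snd w) * snd z)"

lemma character_add: "character (v + w) z = character v z * character w z"
  by (simp add: character_def cis_mult algebra_simps)

lemma character_add_right: "character w (x + z) = character w x * character w z"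
  by (simp add: character_def cis_mult algebra_simps)

lemma character_zero [simp]: "character 0 z = 1"
  by (simp add: character_def)

lemma cnj_character: "cnj (character w z) = character (- w) z"
  by (simp add: character_def cis_cnj algebra_simps)

lemma character_minus_right: "character w (- z) = character (- w) z"
  by (simp add: character_def algebra_simps)

lemma norm_character [simp]: "cmod (character w z) = 1"
  by (simp add: character_def)

lemma sum_roots_of_unity:
  assumes "M > 0"
  shows "(\<Sum>k<M. cis (2 * pi * of_int a * real k / real M)) = (if int M dvd a then of_nat M else 0)"
proof -
  define x where "x = cis (2 * pi * of_int a / real M)"
  have pw: "cis (2 * pi * of_int a * real k / real M) = x ^ k" for k
  proof -
    have "x ^ k = cis (real k * (2 * pi * of_int a / real M))" unfolding x_def by (rule Complex.DeMoivre)
    also have "real k * (2 * pi * of_int a / real M) = 2 * pi * of_int a * real k / real M" by simp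
    finally show ?thesis ..
  qed
  show ?thesis
  proof (cases "int M dvd a")
    case True
    then obtain b where "a = int M * b" by (elim dvdE)
    then have "x = cis (2 * pi * of_int b)" using assms by (simp add: x_def field_simps)
    then have "x = 1" by (simp add: cis_multiple_2pi)
    then show ?thesis using True by (simp add: pw)
  next
    case False
    have "x \<noteq> 1"
    proof
      assume "x = 1"
      then have "cos (2 * pi * of_int a / real M) = 1" by (simp add: x_def complex_eq_iff)
      then obtain b :: int where "2 * pi * of_int a / real M = of_int b * 2 * pi"
        using cos_one_2pi_int by blast
      then have "real_of_int a = of_int b * real M" using assms by (simp add: field_simps)
      then have "a = b * int M" by (metis of_int_eq_iff of_int_mult of_int_of_nat_eq)
      then show False using False by simp
    qed
    moreover have "x ^ M = cis (2 * pi * of_int a)" using pw[of M] assms by simp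
    then have "x ^ M = 1" by (simp add: cis_multiple_2pi)
    ultimately show ?thesis using False by (simp add: pw sum_gp_strict)
  qed
qed

text \<open>Only the inclusion of the spectrum in \<open>S\<close> is recorded and no coefficients
  are named, so that products, splittings and orthogonality can be treated by induction on the
  construction.\<close>

inductive_set trig_poly :: "(int \<times> int) set \<Rightarrow> (real \<times> real \<Rightarrow> complex) set" for S where
  trig_poly_0: "(\<lambda>_. 0) \<in> trig_poly S"
| trig_poly_step: "f \<in> trig_poly S \<Longrightarrow> w \<in> S \<Longrightarrow> (\<lambda>z. f z + c * character w z) \<in> trig_poly S"

lemma trig_poly_monomial: "w \<in> S \<Longrightarrow> (\<lambda>z. c * character w z) \<in> trig_poly S"
  using trig_poly_step[OF trig_poly_0, of w S c] by simp

lemma trig_poly_add: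
  assumes "f \<in> trig_poly S" "g \<in> trig_poly S" shows "(\<lambda>z. f z + g z) \<in> trig_poly S"
  using assms(2)
proof induction
  case trig_poly_0 then show ?case using assms(1) by simp
next
  case (trig_poly_step g w c)
  from trig_poly.trig_poly_step[OF trig_poly_step(3,2), of c] show ?case by (simp add: add.assoc)
qed

lemma trig_poly_mono: "f \<in> trig_poly S \<Longrightarrow> S \<subseteq> T \<Longrightarrow> f \<in> trig_poly T"
  by (induction rule: trig_poly.induct) (auto intro: trig_poly.intros)

lemma trig_poly_cmult: "f \<in> trig_poly S \<Longrightarrow> (\<lambda>z. c * f z) \<in> trig_poly S"
proof (induction rule: trig_poly.induct)
  case trig_poly_0 then show ?case by (simp add: trig_poly.trig_poly_0)
next
  case (trig_poly_step f w d)
  from trig_poly.trig_poly_step[OF trig_poly_step(3,2), of "c * d"] show ?case by (simp add: algebra_simps)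
qed

lemma trig_poly_sum: "(\<And>i. i \<in> I \<Longrightarrow> f i \<in> trig_poly S) \<Longrightarrow> (\<lambda>z. \<Sum>i\<in>I. f i z) \<in> trig_poly S"
  by (induction I rule: infinite_finite_induct) (auto intro: trig_poly_0 trig_poly_add)

lemma trig_poly_mult:
  assumes "f \<in> trig_poly S" "g \<in> trig_poly T" and U: "\<And>v w. v \<in> S \<Longrightarrow> w \<in> T \<Longrightarrow> v + w \<in> U"
  shows "(\<lambda>z. f z * g z) \<in> trig_poly U"
  using assms(1)
proof induction
  case trig_poly_0 then show ?case by (simp add: trig_poly.trig_poly_0)
next
  case (trig_poly_step f v c)
  have "(\<lambda>z. c * character v z * g z) \<in> trig_poly U"
    using assms(2)
  proof induction
    case trig_poly_0 then show ?case by (simp add: trig_poly.trig_poly_0)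
  next
    case (trig_poly_step g w d)
    from trig_poly.trig_poly_step[OF trig_poly_step(3) U[OF \<open>v \<in> S\<close> trig_poly_step(2)], of "c * d"]
    show ?case by (simp add: algebra_simps character_add)
  qed
  from trig_poly_add[OF trig_poly_step(3) this] show ?case by (simp add: algebra_simps)
qed

lemma trig_poly_empty: "f \<in> trig_poly {} \<Longrightarrow> f = (\<lambda>_. 0)"
  by (induction rule: trig_poly.induct) auto

lemma trig_poly_split:
  "f \<in> trig_poly S \<Longrightarrow> \<exists>g\<in>trig_poly (S \<inter> H). \<exists>h\<in>trig_poly (S - H). f = (\<lambda>z. g z + h z)"
proof (induction rule: trig_poly.induct)
  case trig_poly_0 show ?case using trig_poly.trig_poly_0 by force
next
  case (trig_poly_step f w c)
  then obtain g h where gh: "g \<in> trig_poly (S \<inter> H)" "h \<in> trig_poly (S - H)" "f = (\<lambda>z. g z + h z)" by blast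
  show ?case
  proof (cases "w \<in> H")
    case True
    then have "(\<lambda>z. g z + c * character w z) \<in> trig_poly (S \<inter> H)" using gh trig_poly_step by (intro trig_poly.trig_poly_step) auto
    with gh show ?thesis by (intro bexI[of _ "\<lambda>z. g z + c * character w z"] bexI[of _ h]) (auto simp: algebra_simps)
  next
    case False
    then have "(\<lambda>z. h z + c * character w z) \<in> trig_poly (S - H)" using gh trig_poly_step by (intro trig_poly.trig_poly_step) auto
    with gh show ?thesis by (intro bexI[of _ "\<lambda>z. h z + c * character w z"] bexI[of _ g]) (auto simp: algebra_simps)
  qed
qed

lemma trig_poly_coeffs:
  assumes "finite S" "f \<in> trig_poly S"
  shows "\<exists>c. f = (\<lambda>z. \<Sum>w\<in>S. c w * character w z)"
  using assms(2)
proof induction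
  case trig_poly_0 show ?case by (intro exI[of _ "\<lambda>_. 0"]) simp
next
  case (trig_poly_step f w d)
  then obtain c where c: "f = (\<lambda>z. \<Sum>w\<in>S. c w * character w z)" by blast
  have "(\<Sum>v\<in>S. (c v + (if v = w then d else 0)) * character v z) = f z + d * character w z" for z
  proof -
    have "(\<Sum>v\<in>S. (if v = w then d else 0) * character v z) = (\<Sum>v\<in>S. if v = w then d * character v z else 0)"
      by (intro sum.cong) auto
    also have "\<dots> = d * character w z" using assms(1) trig_poly_step(2) by (simp add: sum.delta)
    finally show ?thesis by (simp add: c sum.distrib algebra_simps)
  qed
  then show ?case by (intro exI[of _ "\<lambda>v. c v + (if v = w then d else 0)"]) auto
qed

text \<open>A finite substitute for the integral over the torus, exact up to the factor $M^2$ on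
  trigonometric polynomials of degree less than $M$.\<close>

definition grid_sum :: "nat \<Rightarrow> (real \<times> real \<Rightarrow> 'a::comm_monoid_add) \<Rightarrow> 'a" where
  "grid_sum M f = (\<Sum>(k, l)\<in>{..<M} \<times> {..<M}. f (2 * pi * real k / real M, 2 * pi * real l / real M))"

lemma grid_sum_add: "grid_sum M (\<lambda>z. f z + g z) = grid_sum M f + grid_sum M g"
  by (simp add: grid_sum_def sum.distrib case_prod_unfold)

lemma grid_sum_cmult: "grid_sum M (\<lambda>z. c * f z) = c * grid_sum M f" for c :: "'a::comm_semiring_0"
  by (simp add: grid_sum_def sum_distrib_left case_prod_unfold)

lemma grid_sum_mono: "(\<And>z. f z \<le> g z) \<Longrightarrow> grid_sum M f \<le> (grid_sum M g :: real)"
  unfolding grid_sum_def by (intro sum_mono) (auto simp: case_prod_unfold)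

lemma grid_sum_nonneg: "(\<And>z. 0 \<le> f z) \<Longrightarrow> 0 \<le> (grid_sum M f :: real)"
  unfolding grid_sum_def by (intro sum_nonneg) (auto simp: case_prod_unfold)

lemma grid_sum_const: "grid_sum M (\<lambda>_. c) = real M ^ 2 * c"
  by (simp add: grid_sum_def power2_eq_square)

lemma grid_sum_Re: "Re (grid_sum M f) = grid_sum M (\<lambda>z. Re (f z))"
  by (simp add: grid_sum_def case_prod_unfold)

lemma grid_sum_Cauchy_Schwarz:
  "grid_sum M (\<lambda>z. f z * g z) ^ 2 \<le> grid_sum M (\<lambda>z. f z ^ 2) * (grid_sum M (\<lambda>z. g z ^ 2) :: real)"
  unfolding grid_sum_def case_prod_unfold by (rule Cauchy_Schwarz_ineq_sum)

lemma grid_sum_character: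
  assumes "M > 0"
  shows "grid_sum M (character w) = (if int M dvd fst w \<and> int M dvd snd w then of_nat M ^ 2 else 0)"
proof -
  have "grid_sum M (character w) = (\<Sum>k<M. \<Sum>l<M. cis (2 * pi * of_int (fst w) * real k / real M) *
      cis (2 * pi * of_int (snd w) * real l / real M))"
    unfolding grid_sum_def sum.cartesian_product character_def
    by (intro sum.cong) (auto simp: cis_mult algebra_simps)
  also have "\<dots> = (\<Sum>k<M. cis (2 * pi * of_int (fst w) * real k / real M)) *
      (\<Sum>l<M. cis (2 * pi * of_int (snd w) * real l / real M))"
    by (simp add: sum_product)
  finally show ?thesis using assms by (simp add: sum_roots_of_unity power2_eq_square)
qed

text \<open>Frequencies congruent modulo \<open>M\<close> in both coordinates coincide on the grid,
  so the spectra have to be disjoint modulo \<open>M\<close>. The lower bounds on \<open>M\<close>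
  in the half plane estimates come from here.\<close>

lemma grid_sum_orthogonal:
  assumes "M > 0" "f \<in> trig_poly S" "g \<in> trig_poly T"
    and disj: "\<And>v w. v \<in> S \<Longrightarrow> w \<in> T \<Longrightarrow> \<not> (int M dvd fst (v - w) \<and> int M dvd snd (v - w))"
  shows "grid_sum M (\<lambda>z. f z * cnj (g z)) = 0"
  using assms(2)
proof induction
  case trig_poly_0 then show ?case by (simp add: grid_sum_def)
next
  case (trig_poly_step f v c)
  have "grid_sum M (\<lambda>z. c * character v z * cnj (g z)) = 0"
    using assms(3)
  proof induction
    case trig_poly_0 then show ?case by (simp add: grid_sum_def)
  next
    case (trig_poly_step g w d)
    have "c * character v z * cnj (g z + d * character w z) = c * character v z * cnj (g z) + (c * cnj d) * character (v - w) z" for z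
      by (simp add: algebra_simps cnj_character flip: character_add)
    then show ?case using trig_poly_step(3) disj[OF \<open>v \<in> S\<close> trig_poly_step(2)] assms(1)
      by (simp only: grid_sum_add grid_sum_cmult) (auto simp: grid_sum_character)
  qed
  with trig_poly_step(3) show ?case by (simp add: algebra_simps grid_sum_add)
qed

section \<open>Projection to a half plane of frequencies\<close>

definition freq_box :: "nat \<Rightarrow> (int \<times> int) set" where
  "freq_box d = {(a, b). \<bar>a\<bar> \<le> int d \<and> \<bar>b\<bar> \<le> int d}"

definition half_plane :: "int \<Rightarrow> int \<Rightarrow> int \<Rightarrow> (int \<times> int) set" where
  "half_plane \<alpha> \<beta> K = {(a, b). K < \<alpha> * a + \<beta> * b}"

lemma power_add_le: "(x + y) ^ q \<le> 2 ^ q * (x ^ q + y ^ q)" if "0 \<le> x" "0 \<le> y" for x y :: real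
proof -
  have "(x + y) ^ q \<le> (2 * max x y) ^ q" using that by (intro power_mono) auto
  also have "\<dots> = 2 ^ q * max x y ^ q" by (simp add: power_mult_distrib)
  also have "max x y ^ q \<le> x ^ q + y ^ q" using that by (cases "x \<le> y") (auto simp: max_def)
  finally show ?thesis by simp
qed

lemma freq_box_half_plane_disjoint:
  assumes "2 * d < M" "v \<in> half_plane \<alpha> \<beta> K \<inter> freq_box d" "w \<in> freq_box d - half_plane \<alpha> \<beta> K"
  shows "\<not> (int M dvd fst (v - w) \<and> int M dvd snd (v - w))"
proof
  assume dv: "int M dvd fst (v - w) \<and> int M dvd snd (v - w)"
  obtain a b where v: "v = (a, b)" by (cases v)
  obtain a' b' where w: "w = (a', b')" by (cases w)
  have "\<bar>a - a'\<bar> < int M" "\<bar>b - b'\<bar> < int M"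
    using assms v w by (auto simp: freq_box_def)
  with dv v w have "a - a' = 0" "b - b' = 0"
    using dvd_imp_le_int[of "a - a'" "int M"] dvd_imp_le_int[of "b - b'" "int M"] by auto
  then have "v = w" using v w by simp
  then show False using assms by auto
qed

text \<open>Cotlar's identity: with $u = f + g$, $v = f - g$ and $w = f^2 + g^2$ one has $v^2 = 2w - u^2$ and
  $uv = f^2 - g^2$. Since $f^2$ and $g^2$ have their spectra on opposite sides of the line with
  threshold $2K$, a bound for exponent $q$ applies to the pair $(f^2, g^2)$ and gives one for
  exponent $2q$.\<close>

lemma half_plane_conjugation_bound:
  "\<exists>C\<ge>0. \<forall>d M \<alpha> \<beta> K. \<forall>f\<in>trig_poly (half_plane \<alpha> \<beta> K \<inter> freq_box d). \<forall>g\<in>trig_poly (freq_box d - half_plane \<alpha> \<beta> K). 2 ^ Suc k * d < M \<longrightarrow>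
     grid_sum M (\<lambda>z. cmod (f z - g z) ^ (2 ^ Suc k)) \<le> C * grid_sum M (\<lambda>z. cmod (f z + g z) ^ (2 ^ Suc k))"
proof (induction k)
  case 0
  \<comment> \<open>At exponent 2 the two parts are orthogonal on the grid, so flipping the sign of
    \<open>g\<close> preserves the norm and the constant is 1.\<close>
  have "grid_sum M (\<lambda>z. cmod (f z - g z) ^ 2) = grid_sum M (\<lambda>z. cmod (f z + g z) ^ 2)"
    if fg: "f \<in> trig_poly (half_plane \<alpha> \<beta> K \<inter> freq_box d)" "g \<in> trig_poly (freq_box d - half_plane \<alpha> \<beta> K)" "2 * d < M" for d M \<alpha> \<beta> K f g
  proof -
    have "grid_sum M (\<lambda>z. f z * cnj (g z)) = 0"
      using fg by (intro grid_sum_orthogonal[OF _ fg(1,2)] freq_box_half_plane_disjoint) auto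
    then have z: "grid_sum M (\<lambda>z. Re (f z * cnj (g z))) = 0"
      by (metis grid_sum_Re zero_complex.sel(1))
    have "cmod (f z + g z) ^ 2 = cmod (f z - g z) ^ 2 + 4 * Re (f z * cnj (g z))" for z
      unfolding cmod_power2 by (simp add: power2_eq_square algebra_simps)
    then show ?thesis using z by (simp only: grid_sum_add grid_sum_cmult)
  qed
  then show ?case by (intro exI[of _ 1]) auto
next
  case (Suc k)
  define q where "q = (2::nat) ^ Suc k"
  obtain C where C: "C \<ge> 0" and IH: "\<And>d M \<alpha> \<beta> K f g. f \<in> trig_poly (half_plane \<alpha> \<beta> K \<inter> freq_box d) \<Longrightarrow>
     g \<in> trig_poly (freq_box d - half_plane \<alpha> \<beta> K) \<Longrightarrow> q * d < M \<Longrightarrow>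
     grid_sum M (\<lambda>z. cmod (f z - g z) ^ q) \<le> C * grid_sum M (\<lambda>z. cmod (f z + g z) ^ q)"
    using Suc unfolding q_def by blast
  \<comment> \<open>Both constants are read off from V \<le> A sqrt U sqrt V + 2^q U below: the
    mixed term is at most (A^2 U + V) / 2, and V / 2 is absorbed on the left, which is harmless
    because V is a finite sum.\<close>
  define A where "A = 2 ^ q * 2 ^ q * C"
  define C' where "C' = A\<^sup>2 + 2 * 2 ^ q"
  have "grid_sum M (\<lambda>z. cmod (f z - g z) ^ (2 * q)) \<le> C' * grid_sum M (\<lambda>z. cmod (f z + g z) ^ (2 * q))"
    if fg: "f \<in> trig_poly (half_plane \<alpha> \<beta> K \<inter> freq_box d)" "g \<in> trig_poly (freq_box d - half_plane \<alpha> \<beta> K)" "2 * q * d < M" for d M \<alpha> \<beta> K f g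
  proof -
    define u v w where "u z = f z + g z" and "v z = f z - g z" and "w z = f z ^ 2 + g z ^ 2" for z
    define U V where "U = grid_sum M (\<lambda>z. cmod (u z) ^ (2 * q))" and "V = grid_sum M (\<lambda>z. cmod (v z) ^ (2 * q))"
    have UV: "U \<ge> 0" "V \<ge> 0" by (auto simp: U_def V_def intro!: grid_sum_nonneg)
    \<comment> \<open>Squaring doubles the threshold and the box. The induction hypothesis is
      therefore needed for all \<open>K\<close> and \<open>d\<close>, and the condition on
      \<open>M\<close> is a bound on exponent times degree, which is unchanged when the exponent is
      halved and the degree doubled.\<close>
    have f2: "(\<lambda>z. f z * f z) \<in> trig_poly (half_plane \<alpha> \<beta> (2 * K) \<inter> freq_box (2 * d))"
      by (rule trig_poly_mult[OF fg(1) fg(1)]) (auto simp: half_plane_def freq_box_def algebra_simps)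
    \<comment> \<open>With the minus sign the sum of the new pair is f^2 - g^2 = u v and its
      difference is f^2 + g^2 = w.\<close>
    have g2: "(\<lambda>z. - 1 * (g z * g z)) \<in> trig_poly (freq_box (2 * d) - half_plane \<alpha> \<beta> (2 * K))"
      by (rule trig_poly_cmult, rule trig_poly_mult[OF fg(2) fg(2)]) (auto simp: half_plane_def freq_box_def algebra_simps)
    have "grid_sum M (\<lambda>z. cmod (w z) ^ q) \<le> C * grid_sum M (\<lambda>z. cmod (u z * v z) ^ q)"
      using IH[OF f2 g2, of M] fg(3) by (simp add: u_def v_def w_def power2_eq_square algebra_simps)
    also have "grid_sum M (\<lambda>z. cmod (u z * v z) ^ q) \<le> sqrt (U * V)"
      using grid_sum_Cauchy_Schwarz[of M "\<lambda>z. cmod (u z) ^ q" "\<lambda>z. cmod (v z) ^ q"]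
      by (intro real_le_rsqrt) (simp add: U_def V_def norm_mult power_mult_distrib power_mult [symmetric] mult.commute)
    finally have w: "grid_sum M (\<lambda>z. cmod (w z) ^ q) \<le> C * sqrt (U * V)" using C by (simp add: mult_left_mono)
    have pt: "cmod (v z) ^ (2 * q) \<le> (2 ^ q * 2 ^ q) * cmod (w z) ^ q + 2 ^ q * cmod (u z) ^ (2 * q)" for z
    proof -
      have "v z ^ 2 = 2 * w z - u z ^ 2" by (simp add: u_def v_def w_def power2_eq_square algebra_simps)
      then have "cmod (v z) ^ 2 \<le> 2 * cmod (w z) + cmod (u z) ^ 2"
        by (metis norm_triangle_ineq4 norm_power norm_mult norm_numeral)
      then have "(cmod (v z) ^ 2) ^ q \<le> (2 * cmod (w z) + cmod (u z) ^ 2) ^ q" by (intro power_mono) auto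
      also have "\<dots> \<le> 2 ^ q * ((2 * cmod (w z)) ^ q + (cmod (u z) ^ 2) ^ q)" by (intro power_add_le) auto
      finally show ?thesis by (simp add: power_mult [of _ 2 q] power_mult_distrib distrib_left mult.assoc)
    qed
    have "V \<le> (2 ^ q * 2 ^ q) * grid_sum M (\<lambda>z. cmod (w z) ^ q) + 2 ^ q * U"
      unfolding V_def U_def grid_sum_cmult[symmetric] grid_sum_add[symmetric] by (intro grid_sum_mono pt)
    also have "\<dots> \<le> (2 ^ q * 2 ^ q) * (C * sqrt (U * V)) + 2 ^ q * U"
      by (intro add_right_mono mult_left_mono w) auto
    also have "\<dots> = A * sqrt U * sqrt V + 2 ^ q * U" by (simp add: A_def real_sqrt_mult)
    also have "\<dots> \<le> (A ^ 2 * U + V) / 2 + 2 ^ q * U"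
      using sum_squares_bound[of "A * sqrt U" "sqrt V"] UV by (simp add: power_mult_distrib)
    finally have "V \<le> C' * U" by (simp add: C'_def field_simps)
    then show ?thesis by (simp add: U_def V_def u_def v_def)
  qed
  moreover have "C' \<ge> 0" by (simp add: C'_def)
  ultimately show ?case unfolding q_def by (intro exI[of _ C']) (auto simp: mult.assoc)
qed

text \<open>Twice \<open>f\<close> is the sum of \<open>f + g\<close> and \<open>f - g\<close>, and
  the latter is controlled by the conjugation bound.\<close>

lemma half_plane_projection_bound:
  "\<exists>C\<ge>0. \<forall>d M \<alpha> \<beta> K. \<forall>f\<in>trig_poly (half_plane \<alpha> \<beta> K \<inter> freq_box d). \<forall>g\<in>trig_poly (freq_box d - half_plane \<alpha> \<beta> K). 2 ^ Suc k * d < M \<longrightarrow>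
     grid_sum M (\<lambda>z. cmod (f z) ^ (2 ^ Suc k)) \<le> C * grid_sum M (\<lambda>z. cmod (f z + g z) ^ (2 ^ Suc k))"
proof -
  define q where "q = (2::nat) ^ Suc k"
  obtain C where C: "C \<ge> 0" and bd: "\<And>d M \<alpha> \<beta> K f g. f \<in> trig_poly (half_plane \<alpha> \<beta> K \<inter> freq_box d) \<Longrightarrow>
     g \<in> trig_poly (freq_box d - half_plane \<alpha> \<beta> K) \<Longrightarrow> q * d < M \<Longrightarrow>
     grid_sum M (\<lambda>z. cmod (f z - g z) ^ q) \<le> C * grid_sum M (\<lambda>z. cmod (f z + g z) ^ q)"
    using half_plane_conjugation_bound[of k] unfolding q_def by blast
  have "grid_sum M (\<lambda>z. cmod (f z) ^ q) \<le> (2 ^ q * (C + 1)) * grid_sum M (\<lambda>z. cmod (f z + g z) ^ q)"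
    if fg: "f \<in> trig_poly (half_plane \<alpha> \<beta> K \<inter> freq_box d)" "g \<in> trig_poly (freq_box d - half_plane \<alpha> \<beta> K)" "q * d < M" for d M \<alpha> \<beta> K f g
  proof -
    have pt: "cmod (f z) ^ q \<le> 2 ^ q * (cmod (f z + g z) ^ q + cmod (f z - g z) ^ q)" for z
    proof -
      have "2 * cmod (f z) = cmod ((f z + g z) + (f z - g z))"
        using norm_mult[of 2 "f z"] by simp
      also have "\<dots> \<le> cmod (f z + g z) + cmod (f z - g z)" by (rule norm_triangle_ineq)
      finally have "cmod (f z) \<le> cmod (f z + g z) + cmod (f z - g z)"
        using norm_ge_zero[of "f z"] by linarith
      then have "cmod (f z) ^ q \<le> (cmod (f z + g z) + cmod (f z - g z)) ^ q" by (intro power_mono) auto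
      also have "\<dots> \<le> 2 ^ q * (cmod (f z + g z) ^ q + cmod (f z - g z) ^ q)" by (intro power_add_le) auto
      finally show ?thesis .
    qed
    have "grid_sum M (\<lambda>z. cmod (f z) ^ q) \<le> 2 ^ q * (grid_sum M (\<lambda>z. cmod (f z + g z) ^ q) + grid_sum M (\<lambda>z. cmod (f z - g z) ^ q))"
      unfolding grid_sum_cmult[symmetric] grid_sum_add[symmetric] by (intro grid_sum_mono pt)
    also have "\<dots> \<le> 2 ^ q * (grid_sum M (\<lambda>z. cmod (f z + g z) ^ q) + C * grid_sum M (\<lambda>z. cmod (f z + g z) ^ q))"
      by (intro mult_left_mono add_left_mono bd[OF fg]) auto
    finally show ?thesis by (simp add: algebra_simps)
  qed
  then show ?thesis using C unfolding q_def by (intro exI[of _ "2 ^ 2 ^ Suc k * (C + 1)"]) auto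
qed

section \<open>The node lattice\<close>

lemma cos_cos_character:
  "complex_of_real (cos (of_int a * s) * cos (of_int b * t)) =
     (character (a, b) (s, t) + character (- a, b) (s, t) + character (a, - b) (s, t) + character (- a, - b) (s, t)) / 4"
  by (simp add: character_def complex_eq_iff cos_add sin_add cos_diff sin_diff)

lemma cos_add_2pi_int: "cos (x + 2 * pi * of_int m) = cos x"
  by (simp add: cos_add cos_int_2pin sin_int_2pin)

text \<open>By the three-term recurrence, cos(i u) depends on u only through cos u. This makes
  \<open>cheb_cos\<close> valid for every real s, although arccos(cos s) = s fails outside
  [0, pi].\<close>

lemma cos_mult_cong: "cos u = cos s \<Longrightarrow> cos (real i * u) = cos (real i * s)"
proof -
  assume eq: "cos u = cos s"
  have rec: "cos (real (Suc (Suc i)) * x) = 2 * cos x * cos (real (Suc i) * x) - cos (real i * x)" for i x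
    using cos_times_cos[of x "real (Suc i) * x"] by (simp add: algebra_simps)
  have "cos (real i * u) = cos (real i * s) \<and> cos (real (Suc i) * u) = cos (real (Suc i) * s)" for i
  proof (induction i)
    case 0 then show ?case using eq by simp
  next
    case (Suc i) then show ?case by (simp only: rec eq)
  qed
  then show ?thesis by blast
qed

lemma cheb_cos: "cheb i (cos s) = cos (real i * s)"
  unfolding cheb_def by (rule cos_mult_cong) (simp add: cos_arccos)

lemma finite_Gamma_L:
  assumes "n \<ge> 1" shows "finite (Gamma_L n p)"
proof -
  have "Gamma_L n p \<subseteq> {..n + p} \<times> {..n}"
  proof (rule subrelI)
    fix i j assume "(i, j) \<in> Gamma_L n p"
    then consider "real i / real (n + p) + real j / real n < 1" | "i = 0" "j = n"
      by (auto simp: Gamma_L_def)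
    then show "(i, j) \<in> {..n + p} \<times> {..n}"
    proof cases
      case 1
      moreover have "0 \<le> real i / real (n + p)" "0 \<le> real j / real n" by auto
      ultimately have "real i / real (n + p) < 1" "real j / real n < 1" by linarith+
      then show ?thesis using assms by (simp add: divide_simps)
    qed simp
  qed
  then show ?thesis by (rule finite_subset) simp
qed

lemma Pi_L_cheb: "(i, j) \<in> Gamma_L n p \<Longrightarrow> n \<ge> 1 \<Longrightarrow> (\<lambda>(x, y). c * (cheb i x * cheb j y)) \<in> Pi_L n p"
proof -
  assume ij: "(i, j) \<in> Gamma_L n p" and n: "n \<ge> 1"
  have "(\<Sum>(i', j')\<in>Gamma_L n p. (if (i', j') = (i, j) then c else 0) * (cheb i' x * cheb j' y)) =
      (\<Sum>w\<in>Gamma_L n p. if w = (i, j) then c * (cheb i x * cheb j y) else 0)" for x y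
    by (intro sum.cong) (auto split: if_splits)
  then have "(\<Sum>(i', j')\<in>Gamma_L n p. (if (i', j') = (i, j) then c else 0) * (cheb i' x * cheb j' y)) =
      c * (cheb i x * cheb j y)" for x y
    using ij finite_Gamma_L[OF n] by simp
  then show ?thesis unfolding Pi_L_def by (intro CollectI exI[of _ "\<lambda>w. if w = (i, j) then c else 0"]) auto
qed

lemma Pi_L_add:
  assumes "P \<in> Pi_L n p" "Q \<in> Pi_L n p" shows "(\<lambda>z. P z + Q z) \<in> Pi_L n p"
proof -
  obtain c where c: "P = (\<lambda>(x, y). \<Sum>(i, j)\<in>Gamma_L n p. c (i, j) * (cheb i x * cheb j y))"
    using assms by (auto simp: Pi_L_def)
  obtain d where d: "Q = (\<lambda>(x, y). \<Sum>(i, j)\<in>Gamma_L n p. d (i, j) * (cheb i x * cheb j y))"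
    using assms by (auto simp: Pi_L_def)
  show ?thesis unfolding Pi_L_def
    by (intro CollectI exI[of _ "\<lambda>w. c w + d w"])
       (auto simp: c d fun_eq_iff sum.distrib case_prod_unfold distrib_right)
qed

lemma Pi_L_0: "(\<lambda>_. 0) \<in> Pi_L n p"
  unfolding Pi_L_def by (intro CollectI exI[of _ "\<lambda>_. 0"]) (auto simp: fun_eq_iff)

lemma Pi_L_sum: "(\<And>m. m \<in> I \<Longrightarrow> f m \<in> Pi_L n p) \<Longrightarrow> (\<lambda>z. \<Sum>m\<in>I. f m z) \<in> Pi_L n p"
  by (induction I rule: infinite_finite_induct) (auto intro: Pi_L_add Pi_L_0)

lemma Pi_L_uminus:
  assumes "P \<in> Pi_L n p" shows "(\<lambda>z. - P z) \<in> Pi_L n p"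
proof -
  obtain c where c: "P = (\<lambda>(x, y). \<Sum>(i, j)\<in>Gamma_L n p. c (i, j) * (cheb i x * cheb j y))"
    using assms by (auto simp: Pi_L_def)
  show ?thesis unfolding Pi_L_def
    by (intro CollectI exI[of _ "\<lambda>w. - c w"])
       (auto simp: c fun_eq_iff sum_negf case_prod_unfold)
qed

section \<open>The node group, its dual lattice and the diamond\<close>

locale node_lattice =
  fixes A B :: nat
  assumes A_pos: "A > 0" and B_pos: "B > 0" and coprime_AB: "coprime A B"
begin

text \<open>The angles whose cosines are the interpolation points. The index runs over all integers,
  so that negation and reflection of nodes can be expressed; modulo 2 pi the node depends only on k
  modulo 2 A B.\<close>

definition node :: "int \<Rightarrow> real \<times> real" where
  "node k = (pi * of_int k / real A, pi * of_int k / real B)"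

definition diamond :: "(int \<times> int) set" where
  "diamond = {(a, b). \<bar>a\<bar> * int B + \<bar>b\<bar> * int A < int A * int B}"

lemma character_node:
  "character w (node k) = cis (2 * pi * of_int (fst w * int B + snd w * int A) * of_int k / real (2 * A * B))"
proof -
  have "of_int (fst w) * (pi * of_int k / real A) + of_int (snd w) * (pi * of_int k / real B) =
      2 * pi * of_int (fst w * int B + snd w * int A) * of_int k / real (2 * A * B)"
    using A_pos B_pos by (simp add: field_simps)
  then show ?thesis unfolding character_def node_def fst_conv snd_conv by (rule arg_cong)
qed

lemma sum_character_node:
  "(\<Sum>k<2 * A * B. character w (node (int k))) =
     (if int (2 * A * B) dvd fst w * int B + snd w * int A then of_nat (2 * A * B) else 0)"
  using sum_roots_of_unity[of "2 * A * B" "fst w * int B + snd w * int A"] A_pos B_pos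
  by (simp add: character_node)

lemma int_coprime: "coprime (int A) (int B)"
  using coprime_AB by simp

text \<open>The assumption says that the character of (a, b) is 1 at all nodes. Reducing it modulo A
  and modulo B and using coprimality yields the two divisibilities; dividing by A B leaves the
  parity condition.\<close>

lemma dual_latticeE:
  assumes "int (2 * A * B) dvd a * int B + b * int A"
  obtains u v where "a = int A * u" "b = int B * v" "even (u + v)"
proof -
  obtain w where w: "a * int B + b * int A = int (2 * A * B) * w" using assms by (elim dvdE)
  have "a * int B = int A * (2 * int B * w - b)" "b * int A = int B * (2 * int A * w - a)"
    using w by (auto simp: algebra_simps)
  then have "int A dvd a * int B" "int B dvd b * int A" by (auto intro: dvdI)
  then have "int A dvd a" "int B dvd b"
    using int_coprime by (simp_all add: coprime_dvd_mult_left_iff coprime_commute)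
  then obtain u v where uv: "a = int A * u" "b = int B * v" by (elim dvdE)
  with w have "int A * int B * (u + v) = int A * int B * (2 * w)" by (simp add: algebra_simps)
  then have "u + v = 2 * w" using A_pos B_pos by simp
  then have "even (u + v)" by simp
  then show ?thesis using uv that by blast
qed

text \<open>In the norm |a| / A + |b| / B, a difference of two points of the closed diamond is
  shorter than 2 as soon as one of them is interior, whereas by parity a nonzero vector of the dual
  lattice has length at least 2. Two boundary points can be congruent: (0, B) and (0, -B)
  are.\<close>

lemma diamond_separated:
  assumes "v \<in> diamond \<union> {(0, int B), (0, - int B)}" "w \<in> diamond \<union> {(0, int B), (0, - int B)}"
    and "int (2 * A * B) dvd (fst v - fst w) * int B + (snd v - snd w) * int A"
    and "v \<in> diamond \<or> w \<in> diamond"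
  shows "v = w"
proof -
  obtain a b where v: "v = (a, b)" by (cases v)
  obtain a' b' where w: "w = (a', b')" by (cases w)
  obtain x y where xy: "a - a' = int A * x" "b - b' = int B * y" "even (x + y)"
    using dual_latticeE[of "a - a'" "b - b'"] assms(3) unfolding v w fst_conv snd_conv by blast
  have v1: "\<bar>a\<bar> * int B + \<bar>b\<bar> * int A \<le> int A * int B"
    and w1: "\<bar>a'\<bar> * int B + \<bar>b'\<bar> * int A \<le> int A * int B"
    using assms(1,2) by (auto simp: v w diamond_def)
  have "\<bar>a\<bar> * int B + \<bar>b\<bar> * int A < int A * int B \<or> \<bar>a'\<bar> * int B + \<bar>b'\<bar> * int A < int A * int B"
    using assms(4) by (auto simp: v w diamond_def)
  with v1 w1 have "(\<bar>a\<bar> + \<bar>a'\<bar>) * int B + (\<bar>b\<bar> + \<bar>b'\<bar>) * int A < 2 * (int A * int B)"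
    by (auto simp: algebra_simps)
  moreover have "\<bar>a - a'\<bar> * int B + \<bar>b - b'\<bar> * int A \<le> (\<bar>a\<bar> + \<bar>a'\<bar>) * int B + (\<bar>b\<bar> + \<bar>b'\<bar>) * int A"
    by (intro add_mono mult_right_mono) auto
  moreover have "\<bar>a - a'\<bar> * int B + \<bar>b - b'\<bar> * int A = int A * int B * (\<bar>x\<bar> + \<bar>y\<bar>)"
    by (simp add: xy abs_mult algebra_simps)
  ultimately have "int A * int B * (\<bar>x\<bar> + \<bar>y\<bar>) < int A * int B * 2" by simp
  then have "\<bar>x\<bar> + \<bar>y\<bar> < 2" by (rule mult_left_less_imp_less) simp
  with xy(3) have "x = 0 \<and> y = 0" by presburger
  with xy v w show ?thesis by simp
qed

lemma diamond_bounds: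
  assumes "(a, b) \<in> diamond" shows "\<bar>a\<bar> < int A" "\<bar>b\<bar> < int B"
proof -
  have *: "\<bar>a\<bar> * int B + \<bar>b\<bar> * int A < int A * int B" using assms by (simp add: diamond_def)
  have "0 \<le> \<bar>a\<bar> * int B" "0 \<le> \<bar>b\<bar> * int A" by auto
  with * have "\<bar>a\<bar> * int B < int A * int B" "\<bar>b\<bar> * int A < int A * int B" by linarith+
  then have "int B * \<bar>a\<bar> < int B * int A" "int A * \<bar>b\<bar> < int A * int B" by (simp_all add: mult.commute)
  then show "\<bar>a\<bar> < int A" "\<bar>b\<bar> < int B" by (auto dest: mult_left_less_imp_less)
qed

lemma finite_diamond: "finite diamond"
proof -
  have "diamond \<subseteq> {- int A..int A} \<times> {- int B..int B}"
    by (rule subrelI) (use diamond_bounds in force)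
  then show ?thesis by (rule finite_subset) simp
qed

text \<open>In the coordinates X = a B + b A and Y = a B - b A the diamond is the open square |X|,
  |Y| < N with N = A B, and the dual lattice is generated by shifts of X alone and of Y alone by 2
  N. Reducing both to [-N, N) lands in the square or on an edge, and an edge occurs only for the
  class of N, which the vertex represents.\<close>

lemma diamond_complete:
  "\<exists>w\<in>insert (0, int B) diamond. int (2 * A * B) dvd m - (fst w * int B + snd w * int A)"
proof -
  define N where "N = int A * int B"
  have N: "N > 0" using A_pos B_pos by (simp add: N_def)
  have vertex: ?thesis if "m - N = 2 * N * l" for l
    using that by (intro bexI[of _ "(0, int B)"]) (auto simp: N_def algebra_simps)
  obtain x y where "x * int A + y * int B = 1"
    using bezout_int[of "int A" "int B"] int_coprime by auto
  then have m: "m * y * int B + m * x * int A = m" by (metis add.commute distrib_left mult.assoc mult.right_neutral)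
  define Y where "Y = m * y * int B - m * x * int A"
  \<comment> \<open>Starting from the Bezout representation (m y, m x) of m, the vector i (A, B) + j
    (A, -B) of the dual lattice is subtracted; i reduces X = m and j reduces Y.\<close>
  define i where "i = (m + N) div (2 * N)"
  define j where "j = (Y + N) div (2 * N)"
  define a where "a = m * y - int A * (i + j)"
  define b where "b = m * x - int B * (i - j)"
  have X': "a * int B + b * int A = m - 2 * N * i"
    using m by (simp add: a_def b_def N_def algebra_simps)
  have Y': "a * int B - b * int A = Y - 2 * N * j"
    by (simp add: a_def b_def N_def Y_def algebra_simps)
  have Xr: "m - 2 * N * i = (m + N) mod (2 * N) - N" "Y - 2 * N * j = (Y + N) mod (2 * N) - N"
    unfolding i_def j_def by (simp_all add: minus_div_mult_eq_mod[symmetric] algebra_simps)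
  have r: "0 \<le> (m + N) mod (2 * N)" "(m + N) mod (2 * N) < 2 * N"
      "0 \<le> (Y + N) mod (2 * N)" "(Y + N) mod (2 * N) < 2 * N"
    using N by auto
  consider "a * int B + b * int A = - N" | "a * int B - b * int A = - N"
    | "\<bar>a * int B + b * int A\<bar> < N" "\<bar>a * int B - b * int A\<bar> < N"
    using r by (simp only: X' Y' Xr) linarith
  then show ?thesis
  proof cases
    case 1
    then show ?thesis using X' by (intro vertex[of "i - 1"]) (simp add: algebra_simps)
  next
    case 2
    \<comment> \<open>On the edge Y = -N coprimality forces (a, b) = (A u, B v) with u - v = -1.
      Then X is an odd multiple of N, so m is again in the class of the vertex.\<close>
    have "a * int B = int A * (b - int B)" "b * int A = int B * (a + int A)"
      using 2 by (auto simp: N_def algebra_simps)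
    then have "int A dvd a * int B" "int B dvd b * int A" by (auto intro: dvdI)
    then have "int A dvd a" "int B dvd b"
      using int_coprime by (simp_all add: coprime_dvd_mult_left_iff coprime_commute)
    then obtain u v where uv: "a = int A * u" "b = int B * v" by (elim dvdE)
    with 2 have "N * (u - v) = N * (- 1)" by (simp add: N_def algebra_simps)
    then have "u - v = - 1" using N by (simp only: mult_cancel_left) auto
    then have "u = v - 1" by simp
    moreover have "a * int B + b * int A = N * (u + v)" by (simp add: uv N_def algebra_simps)
    ultimately have "a * int B + b * int A = N * (2 * v - 1)" by simp
    with X' have "m = N * (2 * v - 1) + 2 * N * i" by simp
    then show ?thesis by (intro vertex[of "v - 1 + i"]) (simp add: algebra_simps)
  next
    case 3
    have "\<bar>a\<bar> * int B + \<bar>b\<bar> * int A = \<bar>a * int B\<bar> + \<bar>b * int A\<bar>" by (simp add: abs_mult)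
    also have "\<dots> < N" using 3 by linarith
    finally have "(a, b) \<in> diamond" by (simp add: diamond_def N_def)
    then show ?thesis using X' by (intro bexI[of _ "(a, b)"]) (auto simp: N_def algebra_simps)
  qed
qed

text \<open>The node set is invariant under changing the sign of the first angle alone. The two
  congruences have moduli with greatest common divisor twice that of A and B, namely 2, and they are
  compatible because -k and k have the same parity.\<close>

lemma reflected_node: "\<exists>k'. int (2 * A) dvd k' + k \<and> int (2 * B) dvd k' - k"
proof -
  obtain x y where xy: "x * int A + y * int B = 1"
    using bezout_int[of "int A" "int B"] int_coprime by auto
  have "k = k * (x * int A) + k * (y * int B)" using xy by (metis distrib_left mult.right_neutral)
  then have "k - 2 * k * y * int B + k = int (2 * A) * (x * k)" by (simp add: algebra_simps)
  moreover have "k - 2 * k * y * int B - k = int (2 * B) * (- k * y)" by (simp add: algebra_simps)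
  ultimately show ?thesis by (intro exI[of _ "k - 2 * k * y * int B"]) (metis dvd_triv_left)
qed

text \<open>Discrete Fourier inversion along the nodes, with the frequencies folded into the diamond,
  followed by averaging over the sign changes of the two coordinates.\<close>

lemma cos_expansion:
  fixes h :: "real \<times> real \<Rightarrow> real"
  shows "\<exists>c w. (\<forall>m. w m \<in> insert (0, int B) diamond) \<and>
    (\<forall>k::int. h (cos (fst (node k)), cos (snd (node k))) =
       (\<Sum>m<2 * A * B. c m * (cos (of_int (fst (w m)) * fst (node k)) * cos (of_int (snd (w m)) * snd (node k)))))"
proof -
  define N where "N = 2 * A * B"
  have N: "N > 0" using A_pos B_pos by (simp add: N_def)
  define H where "H k = complex_of_real (h (cos (fst (node k)), cos (snd (node k))))" for k
  define e where "e m k = cis (2 * pi * of_int m * of_int k / real N)" for m k :: int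
  have node_shift: "H k' = H k" "e m k' = e m k" if "k' = k + int N * j" for k k' j m
  proof -
    have "fst (node k') = fst (node k) + 2 * pi * of_int (int B * j)"
         "snd (node k') = snd (node k) + 2 * pi * of_int (int A * j)"
      using A_pos B_pos that by (simp_all add: node_def N_def field_simps)
    then show "H k' = H k" by (simp only: H_def cos_add_2pi_int)
    have "e m k' = e m k * cis (2 * pi * of_int (m * j))"
      using N that by (simp add: e_def cis_mult field_simps)
    then show "e m k' = e m k" by (simp add: cis_multiple_2pi)
  qed
  define c where "c m = (\<Sum>l<N. H (int l) * e (- int m) (int l)) / of_nat N" for m
  \<comment> \<open>Each residue m is a character of the cyclic node group; \<open>w m\<close> is a
    representative of it in the diamond or at the vertex.\<close>
  have "\<exists>w\<in>insert (0, int B) diamond. int N dvd m - (fst w * int B + snd w * int A)" for m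
    using diamond_complete[of m] by (simp add: N_def)
  then obtain w where w: "\<And>m. w m \<in> insert (0, int B) diamond"
     "\<And>m. int N dvd m - (fst (w m) * int B + snd (w m) * int A)" by metis
  have e_character: "e m k = character (w m) (node k)" for m k
  proof -
    obtain j where j: "m = (fst (w m) * int B + snd (w m) * int A) + int N * j"
      using w(2)[of m] by (metis add.commute diff_add_cancel dvdE)
    have "e m k = e (fst (w m) * int B + snd (w m) * int A) k * cis (2 * pi * of_int (j * k))"
      using N by (subst j) (simp add: e_def cis_mult field_simps)
    then show ?thesis by (simp add: cis_multiple_2pi character_node e_def N_def)
  qed
  have inv: "H k = (\<Sum>m<N. c m * character (w (int m)) (node k))" for k
  proof -
    define r where "r = nat (k mod int N)"
    have r: "r < N" "int r = k mod int N" using N by (auto simp: r_def nat_less_iff)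
    have "(\<Sum>m<N. c m * character (w (int m)) (node k)) =
        (\<Sum>m<N. \<Sum>l<N. H (int l) * cis (2 * pi * of_int (k - int l) * real m / real N) / of_nat N)"
    proof (intro sum.cong refl)
      fix m
      have ee: "e (- int m) (int l) * e (int m) k = cis (2 * pi * of_int (k - int l) * real m / real N)" for l
        by (simp add: e_def cis_mult diff_divide_distrib algebra_simps)
      have "c m * character (w (int m)) (node k) = (\<Sum>l<N. H (int l) * (e (- int m) (int l) * e (int m) k) / of_nat N)"
        by (simp add: c_def e_character[symmetric] sum_divide_distrib sum_distrib_right mult.assoc)
      then show "c m * character (w (int m)) (node k) =
          (\<Sum>l<N. H (int l) * cis (2 * pi * of_int (k - int l) * real m / real N) / of_nat N)"
        by (simp only: ee)
    qed
    also have "\<dots> = (\<Sum>l<N. H (int l) / of_nat N * (\<Sum>m<N. cis (2 * pi * of_int (k - int l) * real m / real N)))"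
      by (subst sum.swap) (simp add: sum_distrib_left)
    also have "\<dots> = (\<Sum>l<N. if l = r then H (int l) else 0)"
    proof (intro sum.cong refl)
      fix l assume "l \<in> {..<N}"
      then have "int N dvd k - int l \<longleftrightarrow> l = r"
        using r by (auto simp: mod_eq_dvd_iff[symmetric])
      then show "H (int l) / of_nat N * (\<Sum>m<N. cis (2 * pi * of_int (k - int l) * real m / real N)) =
          (if l = r then H (int l) else 0)"
        using N by (simp only: sum_roots_of_unity) simp
    qed
    also have "\<dots> = H (k mod int N)" using r by simp
    also have "\<dots> = H k"
      by (rule node_shift(1)[of _ _ "- (k div int N)"]) (simp add: minus_mult_div_eq_mod)
    finally show ?thesis ..
  qed
  \<comment> \<open>The inversion formula is evaluated at the reflected node, where the values of
    \<open>h\<close> are the same but the first angle in the characters has changed its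
    sign.\<close>
  have Hrefl: "H k = (\<Sum>m<N. c m * character (w (int m)) (- fst (node k), snd (node k)))" for k
  proof -
    obtain k' where "int (2 * A) dvd k' + k" "int (2 * B) dvd k' - k" using reflected_node by blast
    then obtain u v where uv: "k' + k = int (2 * A) * u" "k' - k = int (2 * B) * v" by (elim dvdE)
    have nk': "fst (node k') = - fst (node k) + 2 * pi * of_int u"
    proof -
      have "of_int k' = real (2 * A) * of_int u - real_of_int k" using uv(1) by (metis add_diff_cancel_right' of_int_diff of_int_mult of_int_of_nat_eq)
      then show ?thesis using A_pos by (simp only: node_def fst_conv) (simp add: divide_simps right_diff_distrib)
    qed
    have nk'2: "snd (node k') = snd (node k) + 2 * pi * of_int v"
    proof -
      have "of_int k' = real (2 * B) * of_int v + real_of_int k" using uv(2) by (metis diff_add_cancel of_int_add of_int_mult of_int_of_nat_eq)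
      then show ?thesis using B_pos by (simp only: node_def snd_conv) (simp add: divide_simps distrib_left)
    qed
    have "H k' = H k" by (simp only: H_def nk' nk'2 cos_add_2pi_int cos_minus)
    moreover have "character w (node k') = character w (- fst (node k), snd (node k))" for w
    proof -
      have "character w (node k') = character w (- fst (node k), snd (node k)) * cis (2 * pi * of_int (fst w * u + snd w * v))"
        by (simp add: character_def nk' nk'2 cis_mult algebra_simps)
      then show ?thesis by (simp add: cis_multiple_2pi)
    qed
    ultimately show ?thesis using inv[of k'] by simp
  qed
  have neg: "node (- k) = - node k" for k by (simp add: node_def)
  have Hneg: "H (- k) = H k" for k by (simp add: H_def neg)
  have "h (cos (fst (node k)), cos (snd (node k))) =
       (\<Sum>m<N. Re (c m) * (cos (of_int (fst (w m)) * fst (node k)) * cos (of_int (snd (w m)) * snd (node k))))" for k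
  proof -
    obtain s t where st: "node k = (s, t)" by (cases "node k")
    have signs: "character v (- s, t) = character (- fst v, snd v) (s, t)" "character v (s, - t) = character (fst v, - snd v) (s, t)"
        "character v (- s, - t) = character (- fst v, - snd v) (s, t)" for v
      by (simp_all add: character_def)
    \<comment> \<open>\<open>H\<close> agrees at all four sign variants of a node, so adding the
      four inversion formulas turns every character into a product of cosines.\<close>
    have four: "4 * H k = H k + H k + H (- k) + H (- k)" by (simp add: Hneg)
    have "4 * H k = (\<Sum>m<N. c m * character (w (int m)) (s, t)) + (\<Sum>m<N. c m * character (w (int m)) (- s, t))
       + (\<Sum>m<N. c m * character (w (int m)) (- s, - t)) + (\<Sum>m<N. c m * character (w (int m)) (s, - t))"
      using inv[of k] Hrefl[of k] inv[of "- k"] Hrefl[of "- k"] unfolding four neg st by simp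
    also have "\<dots> = (\<Sum>m<N. c m * (4 * complex_of_real (cos (of_int (fst (w m)) * s) * cos (of_int (snd (w m)) * t))))"
      unfolding sum.distrib[symmetric] cos_cos_character
    proof (rule sum.cong[OF refl])
      fix m
      have "character (w (int m)) (s, t) = character (fst (w (int m)), snd (w (int m))) (s, t)" by simp
      then show "c m * character (w (int m)) (s, t) + c m * character (w (int m)) (- s, t) + c m * character (w (int m)) (- s, - t) +
          c m * character (w (int m)) (s, - t) =
        c m * (4 * ((character (fst (w (int m)), snd (w (int m))) (s, t) + character (- fst (w (int m)), snd (w (int m))) (s, t) +
          character (fst (w (int m)), - snd (w (int m))) (s, t) + character (- fst (w (int m)), - snd (w (int m))) (s, t)) / 4))"
        unfolding signs by (simp only:) (simp add: algebra_simps)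
    qed
    also have "\<dots> = 4 * (\<Sum>m<N. c m * complex_of_real (cos (of_int (fst (w m)) * s) * cos (of_int (snd (w m)) * t)))"
      by (simp add: sum_distrib_left mult_ac)
    finally have "H k = (\<Sum>m<N. c m * complex_of_real (cos (of_int (fst (w m)) * s) * cos (of_int (snd (w m)) * t)))"
      by simp
    then have "Re (H k) = (\<Sum>m<N. Re (c m) * (cos (of_int (fst (w m)) * s) * cos (of_int (snd (w m)) * t)))"
      by simp
    then show ?thesis by (simp add: H_def st)
  qed
  with w show ?thesis unfolding N_def
    by (intro exI[of _ "\<lambda>m. Re (c m)"] exI[of _ "\<lambda>m. w (int m)"]) auto
qed

text \<open>The vanishing cosine sum is paired with the single character of frequency -w over the
  nodes. Each cosine product splits into four sign variants of its frequency, and by separation in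
  the closed diamond only those coming from w itself can survive.\<close>

lemma cheb_coeffs_eq_zero_if_zero_on_nodes:
  fixes c :: "nat \<times> nat \<Rightarrow> real"
  assumes "finite S" and S: "\<And>i j. (i, j) \<in> S \<Longrightarrow> (int i, int j) \<in> insert (0, int B) diamond"
    and zero: "\<And>k. (\<Sum>(i, j)\<in>S. c (i, j) * (cos (real i * fst (node k)) * cos (real j * snd (node k)))) = 0"
    and uw: "w \<in> S"
  shows "c w = 0"
proof -
  define T where "T v = (\<Sum>k<2 * A * B. complex_of_real (cos (real (fst v) * fst (node (int k))) *
      cos (real (snd v) * snd (node (int k)))) * character (- int (fst w), - int (snd w)) (node (int k)))" for v
  have T4: "4 * T v = (\<Sum>k<2 * A * B. character (int (fst v) - int (fst w), int (snd v) - int (snd w)) (node (int k)))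
     + (\<Sum>k<2 * A * B. character (- int (fst v) - int (fst w), int (snd v) - int (snd w)) (node (int k)))
     + (\<Sum>k<2 * A * B. character (int (fst v) - int (fst w), - int (snd v) - int (snd w)) (node (int k)))
     + (\<Sum>k<2 * A * B. character (- int (fst v) - int (fst w), - int (snd v) - int (snd w)) (node (int k)))" for v
    unfolding T_def sum_distrib_left sum.distrib[symmetric]
  proof (intro sum.cong refl)
    fix k
    obtain s t where st: "node (int k) = (s, t)" by (cases "node (int k)")
    have split: "character (a - int (fst w), b - int (snd w)) (s, t) = character (a, b) (s, t) * character (- int (fst w), - int (snd w)) (s, t)" for a b
      using character_add[of "(a, b)" "(- int (fst w), - int (snd w))"] by simp
    show "4 * (complex_of_real (cos (real (fst v) * fst (node (int k))) * cos (real (snd v) * snd (node (int k)))) *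
        character (- int (fst w), - int (snd w)) (node (int k))) =
      character (int (fst v) - int (fst w), int (snd v) - int (snd w)) (node (int k)) +
      character (- int (fst v) - int (fst w), int (snd v) - int (snd w)) (node (int k)) +
      character (int (fst v) - int (fst w), - int (snd v) - int (snd w)) (node (int k)) +
      character (- int (fst v) - int (fst w), - int (snd v) - int (snd w)) (node (int k))"
      using cos_cos_character[of "int (fst v)" s "int (snd v)" t] unfolding st split
      by (simp only: fst_conv snd_conv of_int_of_nat_eq) (simp add: algebra_simps)
  qed
  have w': "(int (fst w), int (snd w)) \<in> insert (0, int B) diamond" using S[of "fst w" "snd w"] uw by simp
  have off: "T v = 0" if v: "v \<in> S" "v \<noteq> w" for v
  proof -
    have v': "(int (fst v), int (snd v)) \<in> insert (0, int B) diamond" using S[of "fst v" "snd v"] v by simp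
    have nd: "(int (fst v), int (snd v)) \<in> diamond \<or> (int (fst w), int (snd w)) \<in> diamond"
      using v' w' v by (auto simp: prod_eq_iff)
    have "\<not> int (2 * A * B) dvd (\<sigma> * int (fst v) - int (fst w)) * int B + (\<tau> * int (snd v) - int (snd w)) * int A"
      if st: "\<sigma> = 1 \<or> \<sigma> = - 1" "\<tau> = 1 \<or> \<tau> = - 1" for \<sigma> \<tau>
    proof
      assume "int (2 * A * B) dvd (\<sigma> * int (fst v) - int (fst w)) * int B + (\<tau> * int (snd v) - int (snd w)) * int A"
      then have "(\<sigma> * int (fst v), \<tau> * int (snd v)) = (int (fst w), int (snd w))"
        using v' w' nd st by (intro diamond_separated) (auto simp: diamond_def)
      then show False using st v(2) by (auto simp: prod_eq_iff)
    qed
    from this[of 1 1] this[of "-1" 1] this[of 1 "-1"] this[of "-1" "-1"]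
    have "4 * T v = 0" unfolding T4 sum_character_node by simp
    then show ?thesis by simp
  qed
  \<comment> \<open>The first of the four sums is 2 A B and each of the others is 0 or 2 A B, so
    nothing cancels, even on the axes or at the vertex, where several variants coincide on the
    nodes.\<close>
  have "4 * T w \<noteq> 0"
  proof -
    have "Re (4 * T w) > 0" unfolding T4 sum_character_node using A_pos B_pos by simp
    then show ?thesis by auto
  qed
  have "0 = (\<Sum>k<2 * A * B. complex_of_real (\<Sum>(i, j)\<in>S. c (i, j) * (cos (real i * fst (node (int k))) *
      cos (real j * snd (node (int k))))) * character (- int (fst w), - int (snd w)) (node (int k)))"
    by (simp add: zero)
  also have "\<dots> = (\<Sum>v\<in>S. c v * T v)"
    unfolding T_def sum_distrib_left of_real_sum sum_distrib_right
    by (subst sum.swap) (simp add: case_prod_unfold mult_ac)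
  also have "\<dots> = (\<Sum>v\<in>S. if v = w then c w * T w else 0)"
    by (intro sum.cong) (auto simp: off)
  also have "\<dots> = c w * T w" using assms(1) uw by simp
  finally show ?thesis using \<open>4 * T w \<noteq> 0\<close> by auto
qed

section \<open>The stability estimate\<close>

definition dirichlet :: "nat \<Rightarrow> real \<Rightarrow> complex" where
  "dirichlet m s = (\<Sum>a\<in>{0..<int m}. cis (of_int a * s))"

text \<open>These A B frequencies are pairwise incongruent modulo the dual lattice, so their
  characters are orthogonal on the nodes.\<close>

definition base_box :: "(int \<times> int) set" where "base_box = {0..<int A} \<times> {0..<int B}"
definition tripled_box :: "(int \<times> int) set" where "tripled_box = {- int A..<2 * int A} \<times> {- int B..<2 * int B}"

text \<open>The de la Vallee Poussin kernel, as an average of windows \<open>tripled_box\<close> -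
  \<kappa>. The coefficient at (a, b) is the proportion of \<kappa> whose window contains (a, b),
  which is 1 for |a| \<le> A and |b| \<le> B.\<close>

definition kernel :: "real \<times> real \<Rightarrow> complex" where
  "kernel z = (\<Sum>\<kappa>\<in>base_box. \<Sum>\<mu>\<in>tripled_box. character (\<mu> - \<kappa>) z) / of_nat (A * B)"

text \<open>The frequencies form three consecutive blocks of length m, and translating a block
  multiplies its sum by a unimodular factor.\<close>

lemma norm_extended_dirichlet:
  "cmod (\<Sum>a\<in>{- int m..<2 * int m}. cis (of_int a * s)) \<le> 3 * cmod (dirichlet m s)"
proof -
  have shift: "cmod (\<Sum>a\<in>{c..<c + int m}. cis (of_int a * s)) = cmod (dirichlet m s)" for c
  proof -
    have "(\<Sum>a\<in>{c..<c + int m}. cis (of_int a * s)) = (\<Sum>a\<in>{0..<int m}. cis (of_int (a + c) * s))"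
      by (rule sum.reindex_bij_witness[of _ "\<lambda>a. a + c" "\<lambda>a. a - c"]) auto
    also have "\<dots> = cis (of_int c * s) * dirichlet m s"
      by (simp add: dirichlet_def sum_distrib_left cis_mult algebra_simps)
    finally show ?thesis by (simp add: norm_mult)
  qed
  define f where "f a = cis (of_int a * s)" for a
  have "{- int m..<2 * int m} = {- int m..<- int m + int m} \<union> ({0..<0 + int m} \<union> {int m..<int m + int m})"
    by auto
  then have "sum f {- int m..<2 * int m} = sum f {- int m..<- int m + int m} +
      (sum f {0..<0 + int m} + sum f {int m..<int m + int m})"
    by (simp only:) (subst sum.union_disjoint; (subst sum.union_disjoint)?; auto)
  also have "cmod \<dots> \<le> cmod (sum f {- int m..<- int m + int m}) +
      (cmod (sum f {0..<0 + int m}) + cmod (sum f {int m..<int m + int m}))"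
    by (intro order_trans[OF norm_triangle_ineq] add_left_mono norm_triangle_ineq)
  also have "\<dots> = 3 * cmod (dirichlet m s)" unfolding f_def shift by simp
  finally show ?thesis by (simp add: f_def)
qed

lemma sum_character_product:
  "(\<Sum>w\<in>I \<times> J. character w z) = (\<Sum>a\<in>I. cis (of_int a * fst z)) * (\<Sum>b\<in>J. cis (of_int b * snd z))"
  unfolding sum_product sum.cartesian_product
  by (intro sum.cong refl) (auto simp: character_def cis_mult)

text \<open>The double sum factors into the conjugate of the sum over \<open>base_box\<close> and
  the sum over \<open>tripled_box\<close>. Bounding the latter by 9 times the former leaves a
  square, so an l^1 bound over the nodes becomes an l^2 computation.\<close>

lemma norm_kernel_le:
  "cmod (kernel z) \<le> 9 / real (A * B) * cmod (\<Sum>\<kappa>\<in>base_box. character \<kappa> z) ^ 2"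
proof -
  obtain s t where z: "z = (s, t)" by (cases z)
  define D where "D = (\<Sum>\<kappa>\<in>base_box. character \<kappa> z)"
  have D: "D = dirichlet A s * dirichlet B t"
    unfolding D_def base_box_def sum_character_product dirichlet_def by (simp add: z)
  have "(\<Sum>\<kappa>\<in>base_box. \<Sum>\<mu>\<in>tripled_box. character (\<mu> - \<kappa>) z) = cnj D * (\<Sum>\<mu>\<in>tripled_box. character \<mu> z)"
    unfolding D_def cnj_sum cnj_character sum_product by (intro sum.cong refl) (simp flip: character_add)
  then have "cmod (kernel z) = cmod D * cmod (\<Sum>\<mu>\<in>tripled_box. character \<mu> z) / real (A * B)"
    by (simp add: kernel_def norm_divide norm_mult)
  also have "cmod (\<Sum>\<mu>\<in>tripled_box. character \<mu> z) \<le> (3 * cmod (dirichlet A s)) * (3 * cmod (dirichlet B t))"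
    unfolding tripled_box_def sum_character_product norm_mult z fst_conv snd_conv
    by (intro mult_mono norm_extended_dirichlet) auto
  then have "cmod D * cmod (\<Sum>\<mu>\<in>tripled_box. character \<mu> z) / real (A * B) \<le>
      cmod D * ((3 * cmod (dirichlet A s)) * (3 * cmod (dirichlet B t))) / real (A * B)"
    by (intro divide_right_mono mult_left_mono) auto
  also have "\<dots> = 9 / real (A * B) * cmod D ^ 2"
    by (simp add: D norm_mult power2_eq_square)
  finally show ?thesis by (simp add: D_def)
qed

lemma finite_base_box: "finite base_box" by (simp add: base_box_def)

text \<open>By orthogonality on the nodes, the squares of the \<open>base_box\<close> sum add up to
  exactly A B times 2 A B at the translates of any z. This is the source of uniformity in z, A and
  B.\<close>

lemma sum_norm_kernel_le: "(\<Sum>k<2 * A * B. cmod (kernel (z - node (int k)))) \<le> 9 * real (2 * A * B)"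
proof -
  define D where "D z = (\<Sum>\<kappa>\<in>base_box. character \<kappa> z)" for z
  have orth: "(\<Sum>k<2 * A * B. character (\<kappa>' - \<kappa>) (node (int k))) = (if \<kappa> = \<kappa>' then of_nat (2 * A * B) else 0)"
    if "\<kappa> \<in> base_box" "\<kappa>' \<in> base_box" for \<kappa> \<kappa>'
  proof (cases "\<kappa> = \<kappa>'")
    case False
    have "\<not> int (2 * A * B) dvd fst (\<kappa>' - \<kappa>) * int B + snd (\<kappa>' - \<kappa>) * int A"
    proof
      assume "int (2 * A * B) dvd fst (\<kappa>' - \<kappa>) * int B + snd (\<kappa>' - \<kappa>) * int A"
      then obtain u v where uv: "fst (\<kappa>' - \<kappa>) = int A * u" "snd (\<kappa>' - \<kappa>) = int B * v"
        by (rule dual_latticeE)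
      have "\<bar>fst (\<kappa>' - \<kappa>)\<bar> < int A" "\<bar>snd (\<kappa>' - \<kappa>)\<bar> < int B" using that by (auto simp: base_box_def)
      then have "fst (\<kappa>' - \<kappa>) = 0" "snd (\<kappa>' - \<kappa>) = 0"
        using dvd_imp_le_int[of "fst (\<kappa>' - \<kappa>)" "int A", OF _ dvdI[OF uv(1)]]
          dvd_imp_le_int[of "snd (\<kappa>' - \<kappa>)" "int B", OF _ dvdI[OF uv(2)]]
        by linarith+
      then show False using False by (auto simp: prod_eq_iff)
    qed
    then show ?thesis using False unfolding sum_character_node by simp
  qed simp
  have sq: "complex_of_real (cmod (D (z - x)) ^ 2) = (\<Sum>\<kappa>\<in>base_box. \<Sum>\<kappa>'\<in>base_box. character (\<kappa> - \<kappa>') z * character (\<kappa>' - \<kappa>) x)" for x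
  proof -
    have "complex_of_real (cmod (D (z - x)) ^ 2) = D (z - x) * cnj (D (z - x))" by (rule complex_norm_square)
    also have "\<dots> = (\<Sum>\<kappa>\<in>base_box. \<Sum>\<kappa>'\<in>base_box. character (\<kappa> - \<kappa>') (z + - x))"
      unfolding D_def cnj_sum cnj_character sum_product by (intro sum.cong refl) (simp flip: character_add)
    also have "\<dots> = (\<Sum>\<kappa>\<in>base_box. \<Sum>\<kappa>'\<in>base_box. character (\<kappa> - \<kappa>') z * character (\<kappa>' - \<kappa>) x)"
      unfolding character_add_right character_minus_right by simp
    finally show ?thesis .
  qed
  have "complex_of_real (\<Sum>k<2 * A * B. cmod (D (z - node (int k))) ^ 2) =
      (\<Sum>k<2 * A * B. \<Sum>\<kappa>\<in>base_box. \<Sum>\<kappa>'\<in>base_box. character (\<kappa> - \<kappa>') z * character (\<kappa>' - \<kappa>) (node (int k)))"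
    unfolding of_real_sum by (intro sum.cong refl sq)
  also have "\<dots> = (\<Sum>\<kappa>\<in>base_box. \<Sum>\<kappa>'\<in>base_box. character (\<kappa> - \<kappa>') z * (\<Sum>k<2 * A * B. character (\<kappa>' - \<kappa>) (node (int k))))"
    unfolding sum_distrib_left by (subst sum.swap, intro sum.cong refl, rule sum.swap)
  also have "\<dots> = (\<Sum>\<kappa>\<in>base_box. \<Sum>\<kappa>'\<in>base_box. if \<kappa> = \<kappa>' then of_nat (2 * A * B) else 0)"
    by (intro sum.cong refl) (subst orth, auto)
  also have "\<dots> = of_nat (card base_box) * of_nat (2 * A * B)" using finite_base_box by simp
  also have "\<dots> = complex_of_real (real (A * B) * real (2 * A * B))" by (simp add: base_box_def)
  finally have l2: "(\<Sum>k<2 * A * B. cmod (D (z - node (int k))) ^ 2) = real (A * B) * real (2 * A * B)"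
    by (simp only: of_real_eq_iff)
  have "(\<Sum>k<2 * A * B. cmod (kernel (z - node (int k)))) \<le>
      (\<Sum>k<2 * A * B. 9 / real (A * B) * cmod (D (z - node (int k))) ^ 2)"
    unfolding D_def by (intro sum_mono norm_kernel_le)
  also have "\<dots> = 9 * real (2 * A * B)"
    unfolding sum_distrib_left[symmetric] l2 using A_pos B_pos by simp
  finally show ?thesis .
qed

definition dft :: "(real \<times> real \<Rightarrow> complex) \<Rightarrow> int \<times> int \<Rightarrow> complex" where
  "dft \<Phi> w = (\<Sum>k<2 * A * B. \<Phi> (node (int k)) * character (- w) (node (int k))) / of_nat (2 * A * B)"

lemma norm_dft_le:
  assumes "\<And>k. cmod (\<Phi> (node k)) \<le> \<epsilon>" shows "cmod (dft \<Phi> w) \<le> \<epsilon>"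
proof -
  have "cmod (\<Sum>k<2 * A * B. \<Phi> (node (int k)) * character (- w) (node (int k))) \<le> real (card {..<2 * A * B}) * \<epsilon>"
    by (rule sum_norm_bound) (simp add: norm_mult assms)
  then show ?thesis using A_pos B_pos
    by (simp add: dft_def norm_divide norm_mult divide_le_eq mult_ac)
qed

lemma vertex_cos:
  "complex_of_real (cos (real B * snd z)) = (character (0, int B) z + character (0, - int B) z) / 2"
  by (simp add: character_def complex_eq_iff)

text \<open>The vertex lies outside the open diamond, so its cosine is carried as a separate
  summand. The second conclusion exhibits its coefficient as a nodal average, hence bounded by the
  nodal values.\<close>

lemma dft_eq:
  assumes F: "F \<in> trig_poly diamond" and \<Phi>: "\<And>z. \<Phi> z = F z + v * complex_of_real (cos (real B * snd z))"
  shows "F = (\<lambda>z. \<Sum>w\<in>diamond. dft \<Phi> w * character w z)" and "v = dft \<Phi> (0, int B)"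
proof -
  obtain d where d: "F = (\<lambda>z. \<Sum>w\<in>diamond. d w * character w z)"
    using trig_poly_coeffs[OF finite_diamond F] by blast
  have dft: "of_nat (2 * A * B) * dft \<Phi> w =
      (\<Sum>u\<in>diamond. d u * (\<Sum>k<2 * A * B. character (u - w) (node (int k)))) +
      v / 2 * ((\<Sum>k<2 * A * B. character ((0, int B) - w) (node (int k))) +
        (\<Sum>k<2 * A * B. character ((0, - int B) - w) (node (int k))))" for w
  proof -
    have "of_nat (2 * A * B) * dft \<Phi> w = (\<Sum>k<2 * A * B. \<Phi> (node (int k)) * character (- w) (node (int k)))"
      using A_pos B_pos by (simp add: dft_def)
    also have "\<dots> = (\<Sum>k<2 * A * B. (\<Sum>u\<in>diamond. d u * character (u - w) (node (int k))) +
       (v / 2 * character ((0, int B) - w) (node (int k)) + v / 2 * character ((0, - int B) - w) (node (int k))))"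
    proof (intro sum.cong refl)
      fix k
      have sub: "character (u - w) z = character u z * character (- w) z" for u z
        using character_add[of u "- w" z] by simp
      show "\<Phi> (node (int k)) * character (- w) (node (int k)) = (\<Sum>u\<in>diamond. d u * character (u - w) (node (int k))) +
       (v / 2 * character ((0, int B) - w) (node (int k)) + v / 2 * character ((0, - int B) - w) (node (int k)))"
        unfolding \<Phi> d vertex_cos sub by (simp add: sum_distrib_right distrib_left distrib_right mult.assoc)
    qed
    also have "\<dots> = (\<Sum>u\<in>diamond. d u * (\<Sum>k<2 * A * B. character (u - w) (node (int k)))) +
      v / 2 * ((\<Sum>k<2 * A * B. character ((0, int B) - w) (node (int k))) +
        (\<Sum>k<2 * A * B. character ((0, - int B) - w) (node (int k))))"
      unfolding sum.distrib sum_distrib_left distrib_left by (subst sum.swap) simp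
    finally show ?thesis .
  qed
  have N: "complex_of_nat (2 * A * B) \<noteq> 0" using A_pos B_pos by simp
  have orth: "(\<Sum>k<2 * A * B. character (u - w) (node (int k))) = (if u = w then of_nat (2 * A * B) else 0)"
    if "u \<in> diamond \<union> {(0, int B), (0, - int B)}" "w \<in> diamond \<union> {(0, int B), (0, - int B)}"
      "u \<in> diamond \<or> w \<in> diamond" for u w
    using diamond_separated[OF that(1,2) _ that(3)] unfolding sum_character_node by auto
  have vertex: "(0, int B) \<notin> diamond" "(0, - int B) \<notin> diamond" by (auto simp: diamond_def)
  have "dft \<Phi> w = d w" if "w \<in> diamond" for w
  proof -
    have "of_nat (2 * A * B) * dft \<Phi> w = (\<Sum>u\<in>diamond. if u = w then d w * of_nat (2 * A * B) else 0)"
    proof -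
      have "(\<Sum>u\<in>diamond. d u * (\<Sum>k<2 * A * B. character (u - w) (node (int k)))) =
          (\<Sum>u\<in>diamond. if u = w then d w * of_nat (2 * A * B) else 0)"
        using that by (intro sum.cong refl) (subst orth, auto)
      moreover have "(\<Sum>k<2 * A * B. character ((0, int B) - w) (node (int k))) = 0"
        using that vertex by (subst orth) auto
      moreover have "(\<Sum>k<2 * A * B. character ((0, - int B) - w) (node (int k))) = 0"
        using that vertex by (subst orth) auto
      ultimately show ?thesis unfolding dft by simp
    qed
    also have "\<dots> = of_nat (2 * A * B) * d w" using that finite_diamond by simp
    finally show ?thesis using N by (simp only: mult_cancel_left) simp
  qed
  then show "F = (\<lambda>z. \<Sum>w\<in>diamond. dft \<Phi> w * character w z)" using d by simp
  have "of_nat (2 * A * B) * dft \<Phi> (0, int B) = v / 2 * (of_nat (2 * A * B) + of_nat (2 * A * B))"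
  proof -
    have "(\<Sum>u\<in>diamond. d u * (\<Sum>k<2 * A * B. character (u - (0, int B)) (node (int k)))) = 0"
      using vertex by (intro sum.neutral ballI) (subst orth, auto)
    \<comment> \<open>The characters of (0, B) and (0, -B) agree on the nodes, so both halves of the
      cosine contribute and the coefficient is v rather than v / 2.\<close>
    moreover have "int (2 * A * B) dvd fst ((0, - int B) - (0, int B)) * int B + snd ((0, - int B) - (0, int B)) * int A"
      by (intro dvdI[of _ _ "- 1"]) simp
    ultimately show ?thesis unfolding dft sum_character_node by simp
  qed
  then have "of_nat (2 * A * B) * dft \<Phi> (0, int B) = of_nat (2 * A * B) * v" by simp
  then show "v = dft \<Phi> (0, int B)" using N by (simp only: mult_cancel_left) simp
qed

text \<open>The kernel has Fourier coefficient 1 on the diamond, so convolving the nodal values with it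
  gives an extension of $F$ to a larger spectrum which is bounded by the nodal values.\<close>

lemma bounded_extension:
  assumes F: "F \<in> trig_poly diamond" and \<Phi>: "\<And>z. \<Phi> z = F z + v * complex_of_real (cos (real B * snd z))"
    and bd: "\<And>k. cmod (\<Phi> (node k)) \<le> \<epsilon>"
  shows "\<exists>R\<in>trig_poly (freq_box (2 * (A + B)) - diamond). \<forall>z. cmod (F z + R z) \<le> 9 * \<epsilon>"
proof -
  define c where "c = dft \<Phi>"
  define G where "G z = (\<Sum>k<2 * A * B. \<Phi> (node (int k)) * kernel (z - node (int k))) / of_nat (2 * A * B)" for z
  define T where "T \<kappa> = (\<lambda>\<mu>. \<mu> - \<kappa>) ` tripled_box" for \<kappa>
  \<comment> \<open>For every \<kappa> the window \<open>T \<kappa>\<close> contains the diamond,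
    whose part of the convolution is exactly F; averaging over the A B values of \<kappa> keeps F.
    What remains contains aliases of F and of the vertex term, but only its spectrum and the bound
    on the total matter.\<close>
  define R where "R z = (\<Sum>\<kappa>\<in>base_box. 1 / of_nat (A * B) * (\<Sum>w\<in>T \<kappa> - diamond. c w * character w z))" for z
  have T: "diamond \<subseteq> T \<kappa>" "T \<kappa> \<subseteq> freq_box (2 * (A + B))" if "\<kappa> \<in> base_box" for \<kappa>
  proof -
    show "diamond \<subseteq> T \<kappa>"
    proof
      fix w assume "w \<in> diamond"
      then obtain a b where w: "w = (a, b)" and "\<bar>a\<bar> < int A" "\<bar>b\<bar> < int B"
        using diamond_bounds by (metis surj_pair)
      then have "w + \<kappa> \<in> tripled_box" using that by (auto simp: w base_box_def tripled_box_def)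
      then show "w \<in> T \<kappa>" unfolding T_def by (intro image_eqI[of _ _ "w + \<kappa>"]) auto
    qed
    show "T \<kappa> \<subseteq> freq_box (2 * (A + B))" using that by (auto simp: T_def base_box_def tripled_box_def freq_box_def)
  qed
  have finT: "finite (T \<kappa>)" for \<kappa> by (simp add: T_def tripled_box_def)
  have "R \<in> trig_poly (freq_box (2 * (A + B)) - diamond)"
    unfolding R_def
    by (intro trig_poly_sum trig_poly_cmult trig_poly_monomial) (use T in blast)
  moreover have "G z = F z + R z" for z
  proof -
    have conv: "\<Phi> x * kernel (z - x) = 1 / of_nat (A * B) * (\<Sum>\<kappa>\<in>base_box. \<Sum>\<mu>\<in>tripled_box. \<Phi> x * character (- (\<mu> - \<kappa>)) x * character (\<mu> - \<kappa>) z)" for x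
      using character_add_right[of _ z "- x"]
      by (simp add: kernel_def sum_distrib_left sum_divide_distrib character_minus_right mult_ac)
    define X where "X \<kappa> \<mu> k = \<Phi> (node (int k)) * character (- (\<mu> - \<kappa>)) (node (int k)) * character (\<mu> - \<kappa>) z" for \<kappa> \<mu> k
    have "G z = (\<Sum>k<2 * A * B. 1 / of_nat (A * B) * (\<Sum>\<kappa>\<in>base_box. \<Sum>\<mu>\<in>tripled_box. X \<kappa> \<mu> k)) / of_nat (2 * A * B)"
      unfolding G_def conv X_def ..
    also have "\<dots> = 1 / of_nat (A * B) * ((\<Sum>k<2 * A * B. \<Sum>\<kappa>\<in>base_box. \<Sum>\<mu>\<in>tripled_box. X \<kappa> \<mu> k) / of_nat (2 * A * B))"
      by (simp only: sum_distrib_left[symmetric] times_divide_eq_right)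
    also have "(\<Sum>k<2 * A * B. \<Sum>\<kappa>\<in>base_box. \<Sum>\<mu>\<in>tripled_box. X \<kappa> \<mu> k) = (\<Sum>\<kappa>\<in>base_box. \<Sum>\<mu>\<in>tripled_box. \<Sum>k<2 * A * B. X \<kappa> \<mu> k)"
      by (subst sum.swap, intro sum.cong refl, rule sum.swap)
    also have "\<dots> / of_nat (2 * A * B) = (\<Sum>\<kappa>\<in>base_box. \<Sum>\<mu>\<in>tripled_box. (\<Sum>k<2 * A * B. X \<kappa> \<mu> k) / of_nat (2 * A * B))"
      by (simp only: sum_divide_distrib)
    also have "\<dots> = (\<Sum>\<kappa>\<in>base_box. \<Sum>\<mu>\<in>tripled_box. c (\<mu> - \<kappa>) * character (\<mu> - \<kappa>) z)"
      unfolding X_def c_def dft_def sum_distrib_right[symmetric] by simp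
    finally have "G z = 1 / of_nat (A * B) * (\<Sum>\<kappa>\<in>base_box. \<Sum>\<mu>\<in>tripled_box. c (\<mu> - \<kappa>) * character (\<mu> - \<kappa>) z)" .
    also have "(\<Sum>\<kappa>\<in>base_box. \<Sum>\<mu>\<in>tripled_box. c (\<mu> - \<kappa>) * character (\<mu> - \<kappa>) z) =
        (\<Sum>\<kappa>\<in>base_box. F z + (\<Sum>w\<in>T \<kappa> - diamond. c w * character w z))"
    proof (rule sum.cong[OF refl])
      fix \<kappa> assume \<kappa>: "\<kappa> \<in> base_box"
      have "(\<Sum>\<mu>\<in>tripled_box. c (\<mu> - \<kappa>) * character (\<mu> - \<kappa>) z) = (\<Sum>w\<in>T \<kappa>. c w * character w z)"
        unfolding T_def by (subst sum.reindex) (auto simp: inj_on_def)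
      also have "\<dots> = (\<Sum>w\<in>T \<kappa> - diamond. c w * character w z) + (\<Sum>w\<in>diamond. c w * character w z)"
        by (rule sum.subset_diff[OF T(1)[OF \<kappa>] finT])
      also have "(\<Sum>w\<in>diamond. c w * character w z) = F z" unfolding c_def using dft_eq(1)[OF F \<Phi>] by metis
      finally show "(\<Sum>\<mu>\<in>tripled_box. c (\<mu> - \<kappa>) * character (\<mu> - \<kappa>) z) = F z + (\<Sum>w\<in>T \<kappa> - diamond. c w * character w z)"
        by simp
    qed
    finally have Gz: "G z = 1 / of_nat (A * B) * (\<Sum>\<kappa>\<in>base_box. F z + (\<Sum>w\<in>T \<kappa> - diamond. c w * character w z))" .
    show ?thesis
    proof -
      have "R z = 1 / of_nat (A * B) * (\<Sum>\<kappa>\<in>base_box. \<Sum>w\<in>T \<kappa> - diamond. c w * character w z)"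
        unfolding R_def by (rule sum_distrib_left[symmetric])
      moreover have "1 / of_nat (A * B) * (\<Sum>\<kappa>\<in>base_box. F z) = F z"
        using A_pos B_pos by (simp add: base_box_def)
      ultimately show ?thesis unfolding Gz by (simp only: sum.distrib distrib_left)
    qed
  qed
  moreover have "cmod (G z) \<le> 9 * \<epsilon>" for z
  proof -
    have "\<epsilon> \<ge> 0" using bd[of 0] norm_ge_zero order_trans by blast
    have "cmod (\<Sum>k<2 * A * B. \<Phi> (node (int k)) * kernel (z - node (int k))) \<le>
        (\<Sum>k<2 * A * B. \<epsilon> * cmod (kernel (z - node (int k))))"
      by (rule sum_norm_le) (simp add: norm_mult mult_right_mono bd)
    also have "\<dots> \<le> \<epsilon> * (9 * real (2 * A * B))"
      unfolding sum_distrib_left[symmetric] by (intro mult_left_mono sum_norm_kernel_le \<open>\<epsilon> \<ge> 0\<close>)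
    finally show ?thesis using A_pos B_pos
      by (simp add: G_def norm_divide norm_mult divide_le_eq mult_ac)
  qed
  ultimately show ?thesis by metis
qed

lemma diamond_half_planes:
  "diamond = half_plane (int B) (int A) (- int (A * B)) \<inter> half_plane (- int B) (int A) (- int (A * B)) \<inter>
     half_plane (int B) (- int A) (- int (A * B)) \<inter> half_plane (- int B) (- int A) (- int (A * B))"
proof -
  have eq: "\<bar>a\<bar> * int B + \<bar>b\<bar> * int A < int A * int B \<longleftrightarrow>
     \<bar>a * int B\<bar> + \<bar>b * int A\<bar> < int A * int B" for a b by (simp add: abs_mult)
  show ?thesis unfolding diamond_def half_plane_def eq by (auto simp: mult.commute)
qed

end

text \<open>Each projection keeps F, whose spectrum lies in all four half planes, and trims R. After
  the fourth one R would have spectrum both inside and outside the diamond, so it is zero; the cost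
  is C^4.\<close>

lemma diamond_norm_bound:
  "\<exists>C\<ge>0. \<forall>A B F R M E. node_lattice A B \<longrightarrow> F \<in> trig_poly (node_lattice.diamond A B) \<longrightarrow>
     R \<in> trig_poly (freq_box (2 * (A + B)) - node_lattice.diamond A B) \<longrightarrow> (\<forall>z. cmod (F z + R z) \<le> E) \<longrightarrow>
     2 ^ Suc k * (2 * (A + B)) < M \<longrightarrow> grid_sum M (\<lambda>z. cmod (F z) ^ (2 ^ Suc k)) \<le> C * real M ^ 2 * E ^ (2 ^ Suc k)"
proof -
  define q where "q = (2::nat) ^ Suc k"
  obtain C where C: "C \<ge> 0" and bd: "\<And>d M \<alpha> \<beta> K f g. f \<in> trig_poly (half_plane \<alpha> \<beta> K \<inter> freq_box d) \<Longrightarrow>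
     g \<in> trig_poly (freq_box d - half_plane \<alpha> \<beta> K) \<Longrightarrow> q * d < M \<Longrightarrow>
     grid_sum M (\<lambda>z. cmod (f z) ^ q) \<le> C * grid_sum M (\<lambda>z. cmod (f z + g z) ^ q)"
    using half_plane_projection_bound[of k] unfolding q_def by blast
  have step: "\<exists>R'\<in>trig_poly (T \<inter> half_plane \<alpha> \<beta> K). grid_sum M (\<lambda>z. cmod (F z + R' z) ^ q) \<le> C * grid_sum M (\<lambda>z. cmod (F z + R z) ^ q)"
    if F: "F \<in> trig_poly S" "S \<subseteq> half_plane \<alpha> \<beta> K \<inter> freq_box d" and R: "R \<in> trig_poly T" "T \<subseteq> freq_box d" and M: "q * d < M"
    for F R S T \<alpha> \<beta> K d M
  proof -
    obtain g h where gh: "g \<in> trig_poly (T \<inter> half_plane \<alpha> \<beta> K)" "h \<in> trig_poly (T - half_plane \<alpha> \<beta> K)" "R = (\<lambda>z. g z + h z)"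
      using trig_poly_split[OF R(1)] by blast
    have "(\<lambda>z. F z + g z) \<in> trig_poly (half_plane \<alpha> \<beta> K \<inter> freq_box d)"
      using R(2) by (intro trig_poly_add trig_poly_mono[OF F] trig_poly_mono[OF gh(1)]) blast
    moreover have "h \<in> trig_poly (freq_box d - half_plane \<alpha> \<beta> K)" using R(2) by (intro trig_poly_mono[OF gh(2)]) blast
    ultimately have "grid_sum M (\<lambda>z. cmod (F z + g z) ^ q) \<le> C * grid_sum M (\<lambda>z. cmod (F z + g z + h z) ^ q)"
      using M by (rule bd)
    then show ?thesis by (intro bexI[OF _ gh(1)]) (simp add: gh(3) add.assoc)
  qed
  have "grid_sum M (\<lambda>z. cmod (F z) ^ q) \<le> C ^ 4 * real M ^ 2 * E ^ q"
    if nl: "node_lattice A B" and F: "F \<in> trig_poly (node_lattice.diamond A B)"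
      and R: "R \<in> trig_poly (freq_box (2 * (A + B)) - node_lattice.diamond A B)" and E: "\<And>z. cmod (F z + R z) \<le> E"
      and M: "q * (2 * (A + B)) < M" for A B F R M E
  proof -
    interpret node_lattice A B by (rule nl)
    define H1 H2 H3 H4 where "H1 = half_plane (int B) (int A) (- int (A * B))" and "H2 = half_plane (- int B) (int A) (- int (A * B))"
      and "H3 = half_plane (int B) (- int A) (- int (A * B))" and "H4 = half_plane (- int B) (- int A) (- int (A * B))"
    have dia: "diamond = H1 \<inter> H2 \<inter> H3 \<inter> H4" unfolding diamond_half_planes H1_def H2_def H3_def H4_def ..
    define X where "X = freq_box (2 * (A + B))"
    have dX: "diamond \<subseteq> X"
      unfolding X_def freq_box_def by (rule subrelI) (use diamond_bounds in force)
    define g where "g R = grid_sum M (\<lambda>z. cmod (F z + R z) ^ q)" for R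
    obtain R1 where R1: "R1 \<in> trig_poly ((X - diamond) \<inter> H1)" "g R1 \<le> C * g R"
      using step[OF F _ R _ M, of "int B" "int A" "- int (A * B)"] dX dia by (auto simp: g_def X_def H1_def)
    obtain R2 where R2: "R2 \<in> trig_poly (((X - diamond) \<inter> H1) \<inter> H2)" "g R2 \<le> C * g R1"
      using step[OF F _ R1(1) _ M, of "- int B" "int A" "- int (A * B)"] dX dia by (auto simp: g_def X_def H2_def)
    obtain R3 where R3: "R3 \<in> trig_poly ((((X - diamond) \<inter> H1) \<inter> H2) \<inter> H3)" "g R3 \<le> C * g R2"
      using step[OF F _ R2(1) _ M, of "int B" "- int A" "- int (A * B)"] dX dia by (auto simp: g_def X_def H3_def)
    obtain R4 where R4: "R4 \<in> trig_poly (((((X - diamond) \<inter> H1) \<inter> H2) \<inter> H3) \<inter> H4)" "g R4 \<le> C * g R3"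
      using step[OF F _ R3(1) _ M, of "- int B" "- int A" "- int (A * B)"] dX dia by (auto simp: g_def X_def H4_def)
    have "((((X - diamond) \<inter> H1) \<inter> H2) \<inter> H3) \<inter> H4 = {}" using dia by blast
    with R4(1) have "R4 = (\<lambda>_. 0)" by (intro trig_poly_empty) simp
    then have "grid_sum M (\<lambda>z. cmod (F z) ^ q) = g R4" by (simp add: g_def)
    also have "\<dots> \<le> C * (C * (C * (C * g R)))"
      using R1(2) R2(2) R3(2) R4(2) C by (meson mult_left_mono order_trans)
    also have "g R \<le> grid_sum M (\<lambda>_. E ^ q)" unfolding g_def by (intro grid_sum_mono power_mono E) auto
    then have "C * (C * (C * (C * g R))) \<le> C * (C * (C * (C * (real M ^ 2 * E ^ q))))"
      unfolding grid_sum_const by (intro mult_left_mono C)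
    finally show ?thesis by (simp add: numeral_eq_Suc mult_ac)
  qed
  then show ?thesis using C unfolding q_def by (intro exI[of _ "C ^ 4"]) auto
qed

section \<open>The Lagrange interpolant\<close>

lemma node_lattice_nat: "node_lattice (n + p) n" if "n \<ge> 1" "coprime n (n + p)"
  using that by unfold_locales (auto simp: coprime_commute)

lemma Gamma_L_iff_diamond:
  assumes "node_lattice (n + p) n"
  shows "(i, j) \<in> Gamma_L n p \<longleftrightarrow> (int i, int j) \<in> insert (0, int n) (node_lattice.diamond (n + p) n)"
proof -
  interpret node_lattice "n + p" n by (rule assms)
  have "real i / real (n + p) + real j / real n < 1 \<longleftrightarrow> real i * real n + real j * real (n + p) < real (n + p) * real n"
  proof -
    have "x / a + y / b < 1 \<longleftrightarrow> x * b + y * a < a * b" if "a > 0" "b > 0" for x y a b :: real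
      using that by (simp add: field_simps)
    then show ?thesis using A_pos B_pos by (metis of_nat_0_less_iff)
  qed
  also have "\<dots> \<longleftrightarrow> real (i * n + j * (n + p)) < real ((n + p) * n)"
    by (simp only: of_nat_add of_nat_mult)
  also have "\<dots> \<longleftrightarrow> int (i * n + j * (n + p)) < int ((n + p) * n)" by (simp only: of_nat_less_iff)
  also have "\<dots> \<longleftrightarrow> (int i, int j) \<in> diamond" by (simp add: diamond_def)
  finally show ?thesis by (auto simp: Gamma_L_def)
qed

definition curve_point :: "nat \<Rightarrow> nat \<Rightarrow> int \<Rightarrow> real \<times> real" where
  "curve_point n p k = (cos (pi * of_int k / real (n + p)), cos (pi * of_int k / real n))"

text \<open>As a function of k the point is even and has period 2 n (n + p), so the indices from 0
  to n (n + p) already exhaust all integers.\<close>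

lemma LD_eq_curve_points:
  assumes "n \<ge> 1"
  shows "LD n p = range (curve_point n p)"
proof
  have liss: "lissajous n p (pi * real k / real (n * (n + p))) = curve_point n p (int k)" for k
    using assms by (simp add: lissajous_def curve_point_def)
  then show "LD n p \<subseteq> range (curve_point n p)" by (auto simp: LD_def)
  define N where "N = n * (n + p)"
  have N: "N > 0" using assms by (simp add: N_def)
  have shift: "curve_point n p (k + 2 * int N * l) = curve_point n p k" for k l
  proof -
    have "pi * of_int (k + 2 * int N * l) / real (n + p) = pi * of_int k / real (n + p) + 2 * pi * of_int (int n * l)"
      "pi * of_int (k + 2 * int N * l) / real n = pi * of_int k / real n + 2 * pi * of_int (int (n + p) * l)"
      using assms by (simp_all add: N_def field_simps)
    then show ?thesis unfolding curve_point_def by (simp only: cos_add_2pi_int)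
  qed
  have neg: "curve_point n p (- k) = curve_point n p k" for k by (simp add: curve_point_def)
  have small: "curve_point n p (int k) \<in> LD n p" if "k \<le> N" for k
    unfolding LD_def liss[symmetric] using that by (intro CollectI exI[of _ k]) (simp add: N_def)
  have "curve_point n p k \<in> LD n p" for k
  proof -
    define r where "r = k mod (2 * int N)"
    have r: "0 \<le> r" "r < 2 * int N" using N by (auto simp: r_def)
    have kr: "curve_point n p k = curve_point n p r"
      using shift[of r "k div (2 * int N)"] unfolding r_def mod_mult_div_eq .
    show ?thesis
    proof (cases "r \<le> int N")
      case True
      then show ?thesis using kr r small[of "nat r"] by simp
    next
      case False
      have "curve_point n p r = curve_point n p (2 * int N - r)" using shift[of "- r" 1] by (simp add: neg)
      then show ?thesis using kr r False small[of "nat (2 * int N - r)"] by simp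
    qed
  qed
  then show "range (curve_point n p) \<subseteq> LD n p" by blast
qed

lemma Pi_L_torus:
  assumes "node_lattice (n + p) n" "P \<in> Pi_L n p"
  shows "\<exists>F\<in>trig_poly (node_lattice.diamond (n + p) n). \<exists>v.
    \<forall>s t. complex_of_real (P (cos s, cos t)) = F (s, t) + v * complex_of_real (cos (real n * t))"
proof -
  interpret node_lattice "n + p" n by (rule assms)
  obtain c where c: "P = (\<lambda>(x, y). \<Sum>(i, j)\<in>Gamma_L n p. c (i, j) * (cheb i x * cheb j y))"
    using assms by (auto simp: Pi_L_def)
  have fin: "finite (Gamma_L n p)" by (rule finite_Gamma_L) (use B_pos in simp)
  define F where "F z = (\<Sum>w\<in>Gamma_L n p - {(0, n)}. complex_of_real (c w) *
      complex_of_real (cos (of_int (int (fst w)) * fst z) * cos (of_int (int (snd w)) * snd z)))" for z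
  have "F \<in> trig_poly diamond"
    unfolding F_def
  proof (intro trig_poly_sum trig_poly_cmult)
    fix w assume "w \<in> Gamma_L n p - {(0, n)}"
    moreover obtain i j where w: "w = (i, j)" by (cases w)
    ultimately have "(int i, int j) \<in> diamond"
      using Gamma_L_iff_diamond[OF assms(1), of i j] by auto
    then have d: "(int i, int j) \<in> diamond" "(- int i, int j) \<in> diamond" "(int i, - int j) \<in> diamond" "(- int i, - int j) \<in> diamond"
      by (auto simp: diamond_def)
    have "complex_of_real (cos (of_int (int (fst w)) * fst z) * cos (of_int (int (snd w)) * snd z)) =
       1 / 4 * (character (int i, int j) z + character (- int i, int j) z + character (int i, - int j) z + character (- int i, - int j) z)" for z
      using cos_cos_character[of "int i" "fst z" "int j" "snd z"] by (simp add: w)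
    moreover have "(\<lambda>z. 1 / 4 * (character (int i, int j) z + character (- int i, int j) z + character (int i, - int j) z + character (- int i, - int j) z)) \<in> trig_poly diamond"
      by (intro trig_poly_cmult trig_poly_add trig_poly_monomial[where c = 1, simplified] d)
    ultimately show "(\<lambda>z. complex_of_real (cos (of_int (int (fst w)) * fst z) * cos (of_int (int (snd w)) * snd z))) \<in> trig_poly diamond"
      by presburger
  qed
  moreover have "complex_of_real (P (cos s, cos t)) = F (s, t) + complex_of_real (c (0, n)) * complex_of_real (cos (real n * t))" for s t
  proof -
    have "P (cos s, cos t) = (\<Sum>w\<in>Gamma_L n p. c w * (cos (real (fst w) * s) * cos (real (snd w) * t)))"
      by (simp add: c cheb_cos case_prod_unfold)
    also have "\<dots> = (\<Sum>w\<in>Gamma_L n p - {(0, n)}. c w * (cos (real (fst w) * s) * cos (real (snd w) * t))) + c (0, n) * cos (real n * t)"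
      using fin by (subst sum.remove[of _ "(0, n)"]) (auto simp: Gamma_L_def)
    finally show ?thesis by (simp add: F_def)
  qed
  ultimately show ?thesis by blast
qed

lemma Pi_L_interpolation_exists:
  assumes "node_lattice (n + p) n"
  shows "\<exists>P\<in>Pi_L n p. \<forall>z\<in>LD n p. P z = f z"
proof -
  interpret node_lattice "n + p" n by (rule assms)
  have n: "n \<ge> 1" using B_pos by simp
  obtain c w where w: "\<And>m. w m \<in> insert (0, int n) diamond" and
    cw: "\<And>k. f (cos (fst (node k)), cos (snd (node k))) = (\<Sum>m<2 * (n + p) * n. c m *
       (cos (of_int (fst (w m)) * fst (node k)) * cos (of_int (snd (w m)) * snd (node k))))"
    using cos_expansion[of f] by blast
  define P where "P z = (\<Sum>m<2 * (n + p) * n. (\<lambda>(x, y). c m * (cheb (nat \<bar>fst (w m)\<bar>) x * cheb (nat \<bar>snd (w m)\<bar>) y)) z)" for z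
  have "(nat \<bar>fst (w m)\<bar>, nat \<bar>snd (w m)\<bar>) \<in> Gamma_L n p" for m
    using w[of m] by (cases "w m") (auto simp: Gamma_L_iff_diamond[OF assms] diamond_def)
  then have "P \<in> Pi_L n p" unfolding P_def by (intro Pi_L_sum Pi_L_cheb n)
  moreover have "P (curve_point n p k) = f (curve_point n p k)" for k
  proof -
    have cos_abs: "cos (real (nat \<bar>a\<bar>) * s) = cos (of_int a * s)" for a s
      by (cases "a \<ge> 0") (auto simp: abs_if)
    have cp: "curve_point n p k = (cos (fst (node k)), cos (snd (node k)))"
      by (simp add: curve_point_def node_def)
    show ?thesis unfolding cp P_def cw by (simp only: cheb_cos cos_abs split_conv)
  qed
  ultimately show ?thesis using LD_eq_curve_points[OF n] by auto
qed

text \<open>The coefficients themselves are shown to vanish, which gives equality of functions on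
  the whole plane, including points where \<open>cheb\<close> is unspecified. The definite
  description of the interpolant depends on this.\<close>

lemma Pi_L_interpolation_unique:
  assumes "node_lattice (n + p) n" "P \<in> Pi_L n p" "Q \<in> Pi_L n p" "\<forall>z\<in>LD n p. P z = Q z"
  shows "P = Q"
proof -
  interpret node_lattice "n + p" n by (rule assms)
  have n: "n \<ge> 1" using B_pos by simp
  obtain c where c: "(\<lambda>z. P z + - Q z) = (\<lambda>(x, y). \<Sum>(i, j)\<in>Gamma_L n p. c (i, j) * (cheb i x * cheb j y))"
    using Pi_L_add[OF assms(2) Pi_L_uminus[OF assms(3)]] by (auto simp: Pi_L_def)
  have zero: "(\<Sum>(i, j)\<in>Gamma_L n p. c (i, j) * (cos (real i * fst (node k)) * cos (real j * snd (node k)))) = 0" for k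
  proof -
    have cp: "curve_point n p k = (cos (fst (node k)), cos (snd (node k)))"
      by (simp add: curve_point_def node_def)
    have "P (curve_point n p k) + - Q (curve_point n p k) = 0"
      using assms(4) LD_eq_curve_points[OF n] by auto
    then show ?thesis unfolding fun_cong[OF c, of "curve_point n p k"] by (simp add: cp cheb_cos)
  qed
  have "c w = 0" if "w \<in> Gamma_L n p" for w
    using Gamma_L_iff_diamond[OF assms(1)] by (intro cheb_coeffs_eq_zero_if_zero_on_nodes[OF finite_Gamma_L[OF n] _ zero that]) blast
  then have "P z + - Q z = 0" for z
    unfolding fun_cong[OF c, of z] by (cases z) (auto intro!: sum.neutral)
  then show ?thesis by (simp add: fun_eq_iff)
qed

lemma lagrange_interpolant_interpolates:
  assumes "node_lattice (n + p) n"
  shows "lagrange_interpolant n p f \<in> Pi_L n p" "\<And>z. z \<in> LD n p \<Longrightarrow> lagrange_interpolant n p f z = f z"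
proof -
  have "\<exists>!P. P \<in> Pi_L n p \<and> (\<forall>A\<in>LD n p. P A = f A)"
  proof -
    obtain P where P: "P \<in> Pi_L n p" "\<forall>z\<in>LD n p. P z = f z"
      using Pi_L_interpolation_exists[OF assms] by blast
    show ?thesis
    proof (rule ex1I[of _ P])
      fix Q assume "Q \<in> Pi_L n p \<and> (\<forall>A\<in>LD n p. Q A = f A)"
      then show "Q = P" using P by (intro Pi_L_interpolation_unique[OF assms]) auto
    qed (use P in blast)
  qed
  from theI'[OF this] show "lagrange_interpolant n p f \<in> Pi_L n p"
    "\<And>z. z \<in> LD n p \<Longrightarrow> lagrange_interpolant n p f z = f z"
    unfolding lagrange_interpolant_def by blast+
qed

text \<open>P splits into a part F with spectrum in the open diamond and a vertex term v cos(n t). F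
  is controlled through its extension bounded by 9 E, and |v| \<le> E because v is a nodal
  average.\<close>

lemma Pi_L_norm_bound:
  "\<exists>C\<ge>0. \<forall>n p P E M. node_lattice (n + p) n \<longrightarrow> P \<in> Pi_L n p \<longrightarrow> (\<forall>z\<in>LD n p. \<bar>P z\<bar> \<le> E) \<longrightarrow>
     2 ^ Suc k * (2 * (n + p + n)) < M \<longrightarrow>
     grid_sum M (\<lambda>(s, t). P (cos s, cos t) ^ (2 ^ Suc k)) \<le> C * real M ^ 2 * E ^ (2 ^ Suc k)"
proof -
  define q where "q = (2::nat) ^ Suc k"
  have q: "even q" by (simp add: q_def)
  obtain C where C: "C \<ge> 0" and bd: "\<And>A B F R M E. node_lattice A B \<Longrightarrow> F \<in> trig_poly (node_lattice.diamond A B) \<Longrightarrow>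
     R \<in> trig_poly (freq_box (2 * (A + B)) - node_lattice.diamond A B) \<Longrightarrow> (\<forall>z. cmod (F z + R z) \<le> E) \<Longrightarrow>
     q * (2 * (A + B)) < M \<Longrightarrow> grid_sum M (\<lambda>z. cmod (F z) ^ q) \<le> C * real M ^ 2 * E ^ q"
    using diamond_norm_bound[of k] unfolding q_def by blast
  have "grid_sum M (\<lambda>(s, t). P (cos s, cos t) ^ q) \<le> (2 ^ q * (C * 9 ^ q + 1)) * real M ^ 2 * E ^ q"
    if nl: "node_lattice (n + p) n" and P: "P \<in> Pi_L n p" and E: "\<forall>z\<in>LD n p. \<bar>P z\<bar> \<le> E"
      and M: "q * (2 * (n + p + n)) < M" for n p P E M
  proof -
    interpret node_lattice "n + p" n by (rule nl)
    have n: "n \<ge> 1" using B_pos by simp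
    define \<Phi> where "\<Phi> z = complex_of_real (P (cos (fst z), cos (snd z)))" for z :: "real \<times> real"
    obtain F v where F: "F \<in> trig_poly diamond" and Fv: "\<And>s t. complex_of_real (P (cos s, cos t)) = F (s, t) + v * complex_of_real (cos (real n * t))"
      using Pi_L_torus[OF nl P] by blast
    have \<Phi>: "\<Phi> z = F z + v * complex_of_real (cos (real n * snd z))" for z
      using Fv[of "fst z" "snd z"] by (simp add: \<Phi>_def)
    have node: "cmod (\<Phi> (node k)) \<le> E" for k
      using E LD_eq_curve_points[OF n, of p] by (auto simp: \<Phi>_def node_def curve_point_def)
    have v: "cmod v \<le> E" unfolding dft_eq(2)[OF F \<Phi>] by (rule norm_dft_le) (rule node)
    then have E0: "E \<ge> 0" using norm_ge_zero order_trans by blast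
    obtain R where R: "R \<in> trig_poly (freq_box (2 * (n + p + n)) - diamond)" "\<forall>z. cmod (F z + R z) \<le> 9 * E"
      using bounded_extension[of F \<Phi> v E] F \<Phi> node by blast
    have FM: "grid_sum M (\<lambda>z. cmod (F z) ^ q) \<le> C * real M ^ 2 * (9 * E) ^ q"
      by (rule bd[OF nl F R M])
    have pt: "(case z of (s, t) \<Rightarrow> P (cos s, cos t) ^ q) \<le> 2 ^ q * (cmod (F z) ^ q + E ^ q)" for z
    proof -
      have "cmod (\<Phi> z) \<le> cmod (F z) + cmod (v * complex_of_real (cos (real n * snd z)))"
        unfolding \<Phi> by (rule norm_triangle_ineq)
      also have "cmod (v * complex_of_real (cos (real n * snd z))) \<le> E * 1"
        unfolding norm_mult norm_of_real using v E0 by (intro mult_mono) auto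
      finally have "cmod (\<Phi> z) ^ q \<le> (cmod (F z) + E) ^ q" by (intro power_mono) auto
      also have "\<dots> \<le> 2 ^ q * (cmod (F z) ^ q + E ^ q)" using E0 by (intro power_add_le) auto
      finally show ?thesis using q by (simp add: \<Phi>_def case_prod_unfold power_even_abs)
    qed
    have "grid_sum M (\<lambda>(s, t). P (cos s, cos t) ^ q) \<le> grid_sum M (\<lambda>z. 2 ^ q * (cmod (F z) ^ q + E ^ q))"
      by (intro grid_sum_mono pt)
    also have "\<dots> = 2 ^ q * (grid_sum M (\<lambda>z. cmod (F z) ^ q) + real M ^ 2 * E ^ q)"
      by (simp only: grid_sum_cmult grid_sum_add grid_sum_const)
    also have "\<dots> \<le> 2 ^ q * (C * real M ^ 2 * (9 * E) ^ q + real M ^ 2 * E ^ q)"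
      by (intro mult_left_mono add_right_mono FM) auto
    finally show ?thesis by (simp add: power_mult_distrib algebra_simps)
  qed
  then show ?thesis using C unfolding q_def by (intro exI[of _ "2 ^ 2 ^ Suc k * (C * 9 ^ 2 ^ Suc k + 1)"]) auto
qed

section \<open>The Chebyshev weight\<close>

inductive_set cheb_poly :: "(real \<times> real \<Rightarrow> real) set" where
  cheb_poly_monomial: "(\<lambda>z. c * (cheb i (fst z) * cheb j (snd z))) \<in> cheb_poly"
| cheb_poly_add: "f \<in> cheb_poly \<Longrightarrow> g \<in> cheb_poly \<Longrightarrow> (\<lambda>z. f z + g z) \<in> cheb_poly"

lemma cheb_0 [simp]: "cheb 0 x = 1"
  by (simp add: cheb_def)

lemma cheb_poly_const: "(\<lambda>_. c) \<in> cheb_poly"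
  using cheb_poly_monomial[of c 0 0] by simp

lemma cheb_poly_sum: "(\<And>i. i \<in> I \<Longrightarrow> f i \<in> cheb_poly) \<Longrightarrow> (\<lambda>z. \<Sum>i\<in>I. f i z) \<in> cheb_poly"
  by (induction I rule: infinite_finite_induct) (auto intro: cheb_poly_add cheb_poly_const)

text \<open>An identity between cosines of multiples of one angle, so it also holds where
  \<open>arccos x\<close> is unspecified. Hence products stay in \<open>cheb_poly\<close> as
  functions on the whole plane.\<close>

lemma cheb_mult: "cheb i x * cheb k x = (cheb (i + k) x + cheb (nat \<bar>int i - int k\<bar>) x) / 2"
proof -
  have "cos (real (nat \<bar>int i - int k\<bar>) * u) = cos (real i * u - real k * u)" for u
  proof (cases "i \<ge> k")
    case True
    then show ?thesis by (simp add: of_nat_diff nat_diff_distrib algebra_simps)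
  next
    case False
    then have "real (nat \<bar>int i - int k\<bar>) * u = - (real i * u - real k * u)" by (simp add: algebra_simps)
    then show ?thesis by (metis cos_minus)
  qed
  then show ?thesis unfolding cheb_def cos_times_cos by (simp add: algebra_simps)
qed

lemma cheb_poly_mult:
  assumes "f \<in> cheb_poly" "g \<in> cheb_poly" shows "(\<lambda>z. f z * g z) \<in> cheb_poly"
  using assms(1)
proof induction
  case (cheb_poly_monomial c i j)
  show ?case using assms(2)
  proof induction
    case (cheb_poly_monomial d k l)
    have "(\<lambda>z. c * (cheb i (fst z) * cheb j (snd z)) * (d * (cheb k (fst z) * cheb l (snd z)))) =
      (\<lambda>z. (c * d / 4 * (cheb (i + k) (fst z) * cheb (j + l) (snd z)) +
         c * d / 4 * (cheb (i + k) (fst z) * cheb (nat \<bar>int j - int l\<bar>) (snd z))) +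
        (c * d / 4 * (cheb (nat \<bar>int i - int k\<bar>) (fst z) * cheb (j + l) (snd z)) +
         c * d / 4 * (cheb (nat \<bar>int i - int k\<bar>) (fst z) * cheb (nat \<bar>int j - int l\<bar>) (snd z))))"
    proof
      fix z
      have "c * (cheb i (fst z) * cheb j (snd z)) * (d * (cheb k (fst z) * cheb l (snd z))) =
        c * d * (cheb i (fst z) * cheb k (fst z)) * (cheb j (snd z) * cheb l (snd z))" by simp
      then show "c * (cheb i (fst z) * cheb j (snd z)) * (d * (cheb k (fst z) * cheb l (snd z))) =
        (c * d / 4 * (cheb (i + k) (fst z) * cheb (j + l) (snd z)) +
         c * d / 4 * (cheb (i + k) (fst z) * cheb (nat \<bar>int j - int l\<bar>) (snd z))) +
        (c * d / 4 * (cheb (nat \<bar>int i - int k\<bar>) (fst z) * cheb (j + l) (snd z)) +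
         c * d / 4 * (cheb (nat \<bar>int i - int k\<bar>) (fst z) * cheb (nat \<bar>int j - int l\<bar>) (snd z)))"
        unfolding cheb_mult by (simp add: field_simps)
    qed
    then show ?case by (simp only:) (intro cheb_poly.intros)
  next
    case (cheb_poly_add f g)
    from cheb_poly.cheb_poly_add[OF this(3,4)] show ?case by (simp add: distrib_left)
  qed
next
  case (cheb_poly_add f h)
  from cheb_poly.cheb_poly_add[OF this(3,4)] show ?case by (simp add: distrib_right)
qed

lemma cheb_poly_power: "f \<in> cheb_poly \<Longrightarrow> (\<lambda>z. f z ^ m) \<in> cheb_poly"
  by (induction m) (auto intro: cheb_poly_const cheb_poly_mult)

lemma Pi_L_cheb_poly: "P \<in> Pi_L n p \<Longrightarrow> P \<in> cheb_poly"
proof -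
  assume "P \<in> Pi_L n p"
  then obtain c where "P = (\<lambda>z. \<Sum>w\<in>Gamma_L n p. c w * (cheb (fst w) (fst z) * cheb (snd w) (snd z)))"
    by (auto simp: Pi_L_def case_prod_unfold)
  then show ?thesis by (simp only:) (intro cheb_poly_sum cheb_poly_monomial)
qed

text \<open>All (i, j) with i + j < n belong to \<open>Gamma_L n p\<close> whatever p is; this
  uniformity is what permits an arbitrary sequence \<open>p n\<close>.\<close>

lemma cheb_poly_eventually_Pi_L: "g \<in> cheb_poly \<Longrightarrow> \<exists>N. \<forall>n\<ge>N. \<forall>p. g \<in> Pi_L n p"
proof (induction rule: cheb_poly.induct)
  case (cheb_poly_monomial c i j)
  have "(\<lambda>z. c * (cheb i (fst z) * cheb j (snd z))) \<in> Pi_L n p" if "n \<ge> i + j + 1" for n p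
  proof -
    have "real i / real (n + p) \<le> real i / real n" using that by (intro divide_left_mono) auto
    then have "real i / real (n + p) + real j / real n \<le> (real i + real j) / real n"
      by (simp add: add_divide_distrib)
    also have "\<dots> < 1" using that by (simp add: divide_less_eq)
    finally have "(i, j) \<in> Gamma_L n p" by (simp add: Gamma_L_def)
    from Pi_L_cheb[OF this, of c] that show ?thesis by (simp add: case_prod_unfold)
  qed
  then show ?case by blast
next
  case (cheb_poly_add f g)
  then obtain N1 N2 where "\<forall>n\<ge>N1. \<forall>p. f \<in> Pi_L n p" "\<forall>n\<ge>N2. \<forall>p. g \<in> Pi_L n p" by blast
  then show ?case by (intro exI[of _ "max N1 N2"]) (auto intro: Pi_L_add)
qed

lemma polynomial_cheb_poly:
  assumes "real_polynomial_function (g :: real \<times> real \<Rightarrow> real)"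
  shows "\<exists>h\<in>cheb_poly. \<forall>z\<in>{-1..1} \<times> {-1..1}. g z = h z"
  using assms
proof induction
  case (linear f)
  interpret bounded_linear f by fact
  define h where "h z = f (1, 0) * (cheb 1 (fst z) * cheb 0 (snd z)) + f (0, 1) * (cheb 0 (fst z) * cheb 1 (snd z))" for z
  have "h \<in> cheb_poly" unfolding h_def by (intro cheb_poly.intros)
  moreover have "f z = h z" if "z \<in> {-1..1} \<times> {-1..1}" for z
  proof -
    have "f z = f (fst z *\<^sub>R (1, 0) + snd z *\<^sub>R (0, 1))" by simp
    also have "\<dots> = fst z * f (1, 0) + snd z * f (0, 1)" unfolding add scaleR by simp
    finally show ?thesis using that by (auto simp: h_def cheb_def cos_arccos)
  qed
  ultimately show ?case by blast
next
  case (const c)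
  show ?case by (intro bexI[OF _ cheb_poly_const[of c]]) simp
next
  case (add f g)
  then obtain f' g' where "f' \<in> cheb_poly" "g' \<in> cheb_poly" "\<forall>z\<in>{-1..1} \<times> {-1..1}. f z = f' z" "\<forall>z\<in>{-1..1} \<times> {-1..1}. g z = g' z" by blast
  then show ?case by (intro bexI[OF _ cheb_poly_add[of f' g']]) auto
next
  case (mult f g)
  then obtain f' g' where "f' \<in> cheb_poly" "g' \<in> cheb_poly" "\<forall>z\<in>{-1..1} \<times> {-1..1}. f z = f' z" "\<forall>z\<in>{-1..1} \<times> {-1..1}. g z = g' z" by blast
  then show ?case by (intro bexI[OF _ cheb_poly_mult[of f' g']]) auto
qed

section \<open>Integrals against the Chebyshev weight\<close>

lemma chebyshev_weight_Ioo:
  fixes f :: "real \<Rightarrow> real"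
  shows "set_integrable lborel {-1..1} (\<lambda>x. f x / sqrt (1 - x\<^sup>2)) \<longleftrightarrow> set_integrable lborel {-1<..<1} (\<lambda>x. f x / sqrt (1 - x\<^sup>2))"
    and "(LBINT x:{-1..1}. f x / sqrt (1 - x\<^sup>2)) = (LBINT x:{-1<..<1}. f x / sqrt (1 - x\<^sup>2))"
proof -
  \<comment> \<open>At the endpoints division by zero gives 0, so the two integrands agree
    everywhere.\<close>
  have "(\<lambda>x. indicator {-1..1} x *\<^sub>R (f x / sqrt (1 - x\<^sup>2))) = (\<lambda>x. indicator {-1<..<1} x *\<^sub>R (f x / sqrt (1 - x\<^sup>2)))"
  proof
    fix x :: real
    show "indicator {-1..1} x *\<^sub>R (f x / sqrt (1 - x\<^sup>2)) = indicator {-1<..<1} x *\<^sub>R (f x / sqrt (1 - x\<^sup>2))"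
      by (cases "x = 1 \<or> x = - 1") (auto simp: indicator_def)
  qed
  then show "set_integrable lborel {-1..1} (\<lambda>x. f x / sqrt (1 - x\<^sup>2)) \<longleftrightarrow> set_integrable lborel {-1<..<1} (\<lambda>x. f x / sqrt (1 - x\<^sup>2))"
    and "(LBINT x:{-1..1}. f x / sqrt (1 - x\<^sup>2)) = (LBINT x:{-1<..<1}. f x / sqrt (1 - x\<^sup>2))"
    by (simp_all add: set_integrable_def set_lebesgue_integral_def)
qed

lemma chebyshev_weight_pos: "-1 < x \<Longrightarrow> x < 1 \<Longrightarrow> 0 < 1 - x\<^sup>2" for x :: real
  by (simp add: abs_square_less_1)

lemma chebyshev_weight_integral:
  "set_integrable lborel {-1<..<1} (\<lambda>x::real. 1 / sqrt (1 - x\<^sup>2))" (is ?I)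
  "(LBINT x:{-1<..<1}. 1 / sqrt (1 - x\<^sup>2)) = pi" (is ?V)
proof -
  have *: "set_integrable lborel (einterval (ereal (-1)) (ereal 1)) (\<lambda>x. 1 / sqrt (1 - x\<^sup>2))"
    "(LBINT x=ereal (-1)..ereal 1. 1 / sqrt (1 - x\<^sup>2)) = pi / 2 - (- (pi / 2))"
  proof -
    have D: "DERIV arcsin x :> 1 / sqrt (1 - x\<^sup>2)" if "ereal (-1) < ereal x" "ereal x < ereal 1" for x
      using DERIV_arcsin[of x] that by (simp add: inverse_eq_divide)
    have C: "isCont (\<lambda>x. 1 / sqrt (1 - x\<^sup>2)) x" if "ereal (-1) < ereal x" "ereal x < ereal 1" for x
      using that chebyshev_weight_pos[of x] by (intro continuous_intros) auto
    have P: "AE x in lborel. ereal (-1) < ereal x \<longrightarrow> ereal x < ereal 1 \<longrightarrow> 0 \<le> 1 / sqrt (1 - x\<^sup>2)"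
      using chebyshev_weight_pos by (intro AE_I2) (auto intro: less_imp_le)
    have L: "((arcsin \<circ> real_of_ereal) \<longlongrightarrow> - (pi / 2)) (at_right (ereal (-1)))"
      using continuous_on_Icc_at_rightD[OF continuous_on_arcsin'] unfolding ereal_tendsto_simps1 by simp
    have R: "((arcsin \<circ> real_of_ereal) \<longlongrightarrow> pi / 2) (at_left (ereal 1))"
      using continuous_on_Icc_at_leftD[OF continuous_on_arcsin'] unfolding ereal_tendsto_simps1 by simp
    show "set_integrable lborel (einterval (ereal (-1)) (ereal 1)) (\<lambda>x. 1 / sqrt (1 - x\<^sup>2))"
      by (rule interval_integral_FTC_nonneg(1)[OF _ D C P L R]) simp
    show "(LBINT x=ereal (-1)..ereal 1. 1 / sqrt (1 - x\<^sup>2)) = pi / 2 - (- (pi / 2))"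
      by (rule interval_integral_FTC_nonneg(2)[OF _ D C P L R]) simp
  qed
  show ?I using *(1) by (simp only: einterval_eq_Icc)
  have "(LBINT x=ereal (-1)..ereal 1. 1 / sqrt (1 - x\<^sup>2)) = (LBINT x:{-1<..<1}. 1 / sqrt (1 - x\<^sup>2))"
  proof -
    have "ereal (-1) \<le> ereal 1" by simp
    from interval_lebesgue_integral_le_eq[OF this] show ?thesis by (simp only: einterval_eq_Icc)
  qed
  then show ?V using *(2) by simp
qed

lemma cheb_integrable: "set_integrable lborel {-1..1} (\<lambda>x. cheb i x / sqrt (1 - x\<^sup>2))"
  unfolding chebyshev_weight_Ioo(1)
proof (rule set_integrable_bound[OF chebyshev_weight_integral(1)])
  have "continuous_on {-1<..<1} (\<lambda>x. cheb i x / sqrt (1 - x\<^sup>2))"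
    unfolding cheb_def
    by (intro continuous_intros) (use chebyshev_weight_pos in \<open>force simp: abs_le_iff\<close>)+
  then show "set_borel_measurable lborel {-1<..<1} (\<lambda>x. cheb i x / sqrt (1 - x\<^sup>2))"
    using borel_measurable_continuous_on_indicator[of "{-1<..<1}" "\<lambda>x. cheb i x / sqrt (1 - x\<^sup>2)"] by (simp add: set_borel_measurable_def)
  show "AE x in lborel. x \<in> {-1<..<1} \<longrightarrow> norm (cheb i x / sqrt (1 - x\<^sup>2)) \<le> norm (1 / sqrt (1 - x\<^sup>2))"
    by (intro AE_I2 impI) (auto simp: cheb_def intro!: divide_right_mono)
qed

lemma cheb_integral: "(LBINT x:{-1..1}. cheb i x / sqrt (1 - x\<^sup>2)) = (if i = 0 then pi else 0)"
proof (cases "i = 0")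
  case True
  then show ?thesis unfolding chebyshev_weight_Ioo(2) using chebyshev_weight_integral(2) by simp
next
  case False
  \<comment> \<open>An antiderivative on the open interval; it vanishes at both ends because sin 0 =
    sin(i pi) = 0.\<close>
  define F where "F x = - sin (real i * arccos x) / real i" for x
  have D: "(F has_vector_derivative cheb i x / sqrt (1 - x\<^sup>2)) (at x)" if "ereal (-1) < ereal x" "ereal x < ereal 1" for x
  proof -
    have "(F has_real_derivative cheb i x / sqrt (1 - x\<^sup>2)) (at x)"
      unfolding F_def cheb_def using that False
      by (auto intro!: derivative_eq_intros DERIV_arccos simp: field_simps)
    then show ?thesis by (simp add: has_real_derivative_iff_has_vector_derivative)
  qed
  have C: "isCont (\<lambda>x. cheb i x / sqrt (1 - x\<^sup>2)) x" if "ereal (-1) < ereal x" "ereal x < ereal 1" for x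
    using that chebyshev_weight_pos[of x] unfolding cheb_def by (intro continuous_intros isCont_arccos) auto
  have I: "set_integrable lborel (einterval (ereal (-1)) (ereal 1)) (\<lambda>x. cheb i x / sqrt (1 - x\<^sup>2))"
    using cheb_integrable[of i] unfolding chebyshev_weight_Ioo(1) einterval_eq_Icc .
  have "continuous_on {-1..1} F"
    unfolding F_def by (intro continuous_intros continuous_on_arccos') (use False in auto)
  then have L: "((F \<circ> real_of_ereal) \<longlongrightarrow> 0) (at_right (ereal (-1)))"
    and R: "((F \<circ> real_of_ereal) \<longlongrightarrow> 0) (at_left (ereal 1))"
    using continuous_on_Icc_at_rightD[of "-1" 1 F] continuous_on_Icc_at_leftD[of "-1" 1 F]
    unfolding ereal_tendsto_simps1 by (simp_all add: F_def)
  have "(LBINT x=ereal (-1)..ereal 1. cheb i x / sqrt (1 - x\<^sup>2)) = 0 - 0"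
    by (rule interval_integral_FTC_integrable[OF _ D C I L R]) simp
  moreover have "(LBINT x=ereal (-1)..ereal 1. cheb i x / sqrt (1 - x\<^sup>2)) = (LBINT x:{-1<..<1}. cheb i x / sqrt (1 - x\<^sup>2))"
  proof -
    have "ereal (-1) \<le> ereal 1" by simp
    from interval_lebesgue_integral_le_eq[OF this] show ?thesis by (simp only: einterval_eq_Icc)
  qed
  ultimately show ?thesis using False unfolding chebyshev_weight_Ioo(2) by simp
qed

lemma grid_sum_cos_cos:
  assumes "i < M" "j < M"
  shows "grid_sum M (\<lambda>(s, t). cos (real i * s) * cos (real j * t)) = (if i = 0 \<and> j = 0 then real M ^ 2 else 0)"
proof -
  have M: "M > 0" using assms by simp
  have zero: "int M dvd \<sigma> * int i \<longleftrightarrow> i = 0" "int M dvd \<sigma> * int j \<longleftrightarrow> j = 0" if "\<sigma> = 1 \<or> \<sigma> = - 1" for \<sigma>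
    using assms that by (auto dest!: dvd_imp_le)
  have "complex_of_real (grid_sum M (\<lambda>(s, t). cos (real i * s) * cos (real j * t))) =
     grid_sum M (\<lambda>z. 1 / 4 * (character (int i, int j) z + character (- int i, int j) z + character (int i, - int j) z + character (- int i, - int j) z))"
    unfolding grid_sum_def of_real_sum
  proof (intro sum.cong refl, clarify)
    fix k l
    show "complex_of_real (cos (real i * (2 * pi * real k / real M)) * cos (real j * (2 * pi * real l / real M))) =
      1 / 4 * (character (int i, int j) (2 * pi * real k / real M, 2 * pi * real l / real M) +
        character (- int i, int j) (2 * pi * real k / real M, 2 * pi * real l / real M) +
        character (int i, - int j) (2 * pi * real k / real M, 2 * pi * real l / real M) +
        character (- int i, - int j) (2 * pi * real k / real M, 2 * pi * real l / real M))"
      using cos_cos_character[of "int i" "2 * pi * real k / real M" "int j" "2 * pi * real l / real M"] by simp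
  qed
  also have "\<dots> = complex_of_real (if i = 0 \<and> j = 0 then real M ^ 2 else 0)"
    unfolding grid_sum_cmult grid_sum_add grid_sum_character[OF M] using zero[of 1] zero[of "- 1"] by simp
  finally show ?thesis by (simp only: of_real_eq_iff)
qed

text \<open>On a monomial both sides vanish unless i = j = 0, when both equal c pi^2 M^2; a large M
  excludes aliasing. The two integrability statements are carried along to make the iterated
  integral additive in the induction.\<close>

lemma cheb_poly_integral:
  assumes "g \<in> cheb_poly"
  shows "(\<forall>y. set_integrable lborel {-1..1} (\<lambda>x. g (x, y) / (sqrt (1 - x\<^sup>2) * sqrt (1 - y\<^sup>2)))) \<and>
    set_integrable lborel {-1..1} (\<lambda>y. LBINT x:{-1..1}. g (x, y) / (sqrt (1 - x\<^sup>2) * sqrt (1 - y\<^sup>2))) \<and>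
    (\<exists>N. \<forall>M\<ge>N. real M ^ 2 * (LBINT y:{-1..1}. LBINT x:{-1..1}. g (x, y) / (sqrt (1 - x\<^sup>2) * sqrt (1 - y\<^sup>2))) =
       pi\<^sup>2 * grid_sum M (\<lambda>(s, t). g (cos s, cos t)))"
  using assms
proof induction
  case (cheb_poly_monomial c i j)
  have eq: "c * (cheb i (fst (x, y)) * cheb j (snd (x, y))) / (sqrt (1 - x\<^sup>2) * sqrt (1 - y\<^sup>2)) =
     (c * (cheb j y / sqrt (1 - y\<^sup>2))) * (cheb i x / sqrt (1 - x\<^sup>2))" for x y
    by (simp add: mult_ac)
  have inner: "(LBINT x:{-1..1}. (c * (cheb j y / sqrt (1 - y\<^sup>2))) * (cheb i x / sqrt (1 - x\<^sup>2))) =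
     (c * (if i = 0 then pi else 0)) * (cheb j y / sqrt (1 - y\<^sup>2))" for y
    unfolding set_integral_mult_right cheb_integral by simp
  have "real M ^ 2 * (LBINT y:{-1..1}. (c * (if i = 0 then pi else 0)) * (cheb j y / sqrt (1 - y\<^sup>2))) =
       pi\<^sup>2 * grid_sum M (\<lambda>(s, t). c * (cheb i (fst (cos s, cos t)) * cheb j (snd (cos s, cos t))))"
    if "M \<ge> i + j + 1" for M
  proof -
    have "grid_sum M (\<lambda>(s, t). c * (cheb i (fst (cos s, cos t)) * cheb j (snd (cos s, cos t)))) =
      c * grid_sum M (\<lambda>(s, t). cos (real i * s) * cos (real j * t))"
      by (simp add: cheb_cos case_prod_unfold grid_sum_cmult)
    also have "\<dots> = c * (if i = 0 \<and> j = 0 then real M ^ 2 else 0)" using that by (subst grid_sum_cos_cos) auto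
    finally show ?thesis unfolding set_integral_mult_right cheb_integral by (simp add: power2_eq_square)
  qed
  then show ?case unfolding eq inner
    by (intro conjI allI impI set_integrable_mult_right cheb_integrable exI[of _ "i + j + 1"])
next
  case (cheb_poly_add f g)
  let ?w = "\<lambda>x y :: real. sqrt (1 - x\<^sup>2) * sqrt (1 - y\<^sup>2)"
  have split: "(f (x, y) + g (x, y)) / ?w x y = f (x, y) / ?w x y + g (x, y) / ?w x y" for x y
    by (rule add_divide_distrib)
  have inner: "(LBINT x:{-1..1}. f (x, y) / ?w x y + g (x, y) / ?w x y) =
     (LBINT x:{-1..1}. f (x, y) / ?w x y) + (LBINT x:{-1..1}. g (x, y) / ?w x y)" for y
    using cheb_poly_add by (intro set_integral_add) auto
  obtain N1 N2 where N: "\<forall>M\<ge>N1. real M ^ 2 * (LBINT y:{-1..1}. LBINT x:{-1..1}. f (x, y) / ?w x y) = pi\<^sup>2 * grid_sum M (\<lambda>(s, t). f (cos s, cos t))"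
    "\<forall>M\<ge>N2. real M ^ 2 * (LBINT y:{-1..1}. LBINT x:{-1..1}. g (x, y) / ?w x y) = pi\<^sup>2 * grid_sum M (\<lambda>(s, t). g (cos s, cos t))"
    using cheb_poly_add by blast
  have outer: "(LBINT y:{-1..1}. (LBINT x:{-1..1}. f (x, y) / ?w x y) + (LBINT x:{-1..1}. g (x, y) / ?w x y)) =
     (LBINT y:{-1..1}. LBINT x:{-1..1}. f (x, y) / ?w x y) + (LBINT y:{-1..1}. LBINT x:{-1..1}. g (x, y) / ?w x y)"
    using cheb_poly_add by (intro set_integral_add) auto
  have "real M ^ 2 * (LBINT y:{-1..1}. (LBINT x:{-1..1}. f (x, y) / ?w x y) + (LBINT x:{-1..1}. g (x, y) / ?w x y)) =
     pi\<^sup>2 * grid_sum M (\<lambda>(s, t). f (cos s, cos t) + g (cos s, cos t))" if "M \<ge> max N1 N2" for M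
    using N that unfolding outer case_prod_unfold grid_sum_add by (simp add: distrib_left)
  then show ?case unfolding split inner using cheb_poly_add by (intro conjI allI set_integral_add exI[of _ "max N1 N2"]) auto
qed

text \<open>Only the majorant is assumed integrable: if \<open>f\<close> is not, its integral is 0
  by convention, which lies below the integral of \<open>g\<close> because g \<ge> 0 on A.
  Measurability of the inner integrals of the error thus never has to be established.\<close>

lemma set_integral_mono_nonneg:
  fixes f g :: "real \<Rightarrow> real"
  assumes "set_integrable lborel A g" "\<And>x. x \<in> A \<Longrightarrow> 0 \<le> f x" "\<And>x. x \<in> A \<Longrightarrow> f x \<le> g x"
  shows "0 \<le> (LBINT x:A. f x)" "(LBINT x:A. f x) \<le> (LBINT x:A. g x)"
proof -
  show "0 \<le> (LBINT x:A. f x)"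
    unfolding set_lebesgue_integral_def using assms(2) by (intro integral_nonneg_AE AE_I2) (auto simp: indicator_def)
  show "(LBINT x:A. f x) \<le> (LBINT x:A. g x)"
    using assms(1) unfolding set_lebesgue_integral_def set_integrable_def
    by (rule integral_mono') (use assms(2,3) in \<open>auto simp: indicator_def intro: order_trans\<close>)
qed

lemma cheb_integral_le_grid_sum:
  assumes "U \<in> cheb_poly" and g: "\<And>x y. x \<in> {-1..1} \<Longrightarrow> y \<in> {-1..1} \<Longrightarrow> 0 \<le> g (x, y) \<and> g (x, y) \<le> U (x, y)"
  shows "\<exists>N. \<forall>M\<ge>N. 0 \<le> (LBINT y:{-1..1}. LBINT x:{-1..1}. g (x, y) / (sqrt (1 - x\<^sup>2) * sqrt (1 - y\<^sup>2))) \<and>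
    real M ^ 2 * (LBINT y:{-1..1}. LBINT x:{-1..1}. g (x, y) / (sqrt (1 - x\<^sup>2) * sqrt (1 - y\<^sup>2))) \<le>
       pi\<^sup>2 * grid_sum M (\<lambda>(s, t). U (cos s, cos t))"
proof -
  let ?w = "\<lambda>x y :: real. sqrt (1 - x\<^sup>2) * sqrt (1 - y\<^sup>2)"
  have w: "0 \<le> ?w x y" if "x \<in> {-1..1}" "y \<in> {-1..1}" for x y
    using that by (simp add: abs_square_le_1 abs_le_iff)
  note U = cheb_poly_integral[OF assms(1)]
  have inner: "0 \<le> (LBINT x:{-1..1}. g (x, y) / ?w x y)"
    "(LBINT x:{-1..1}. g (x, y) / ?w x y) \<le> (LBINT x:{-1..1}. U (x, y) / ?w x y)" if "y \<in> {-1..1}" for y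
  proof -
    have int: "set_integrable lborel {-1..1} (\<lambda>x. U (x, y) / ?w x y)" using U by blast
    have bd: "0 \<le> g (x, y) / ?w x y" "g (x, y) / ?w x y \<le> U (x, y) / ?w x y" if "x \<in> {-1..1}" for x
      using g[OF that \<open>y \<in> {-1..1}\<close>] w[OF that \<open>y \<in> {-1..1}\<close>]
      by (auto intro: divide_nonneg_nonneg divide_right_mono)
    from set_integral_mono_nonneg[OF int bd]
    show "0 \<le> (LBINT x:{-1..1}. g (x, y) / ?w x y)"
      "(LBINT x:{-1..1}. g (x, y) / ?w x y) \<le> (LBINT x:{-1..1}. U (x, y) / ?w x y)" by blast+
  qed
  have outer: "0 \<le> (LBINT y:{-1..1}. LBINT x:{-1..1}. g (x, y) / ?w x y)"
    "(LBINT y:{-1..1}. LBINT x:{-1..1}. g (x, y) / ?w x y) \<le> (LBINT y:{-1..1}. LBINT x:{-1..1}. U (x, y) / ?w x y)"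
  proof -
    have "set_integrable lborel {-1..1} (\<lambda>y. LBINT x:{-1..1}. U (x, y) / ?w x y)" using U by blast
    from set_integral_mono_nonneg[OF this inner]
    show "0 \<le> (LBINT y:{-1..1}. LBINT x:{-1..1}. g (x, y) / ?w x y)"
      "(LBINT y:{-1..1}. LBINT x:{-1..1}. g (x, y) / ?w x y) \<le> (LBINT y:{-1..1}. LBINT x:{-1..1}. U (x, y) / ?w x y)" by blast+
  qed
  obtain N where N: "\<forall>M\<ge>N. real M ^ 2 * (LBINT y:{-1..1}. LBINT x:{-1..1}. U (x, y) / ?w x y) = pi\<^sup>2 * grid_sum M (\<lambda>(s, t). U (cos s, cos t))"
    using U by blast
  have "real M ^ 2 * (LBINT y:{-1..1}. LBINT x:{-1..1}. g (x, y) / ?w x y) \<le> pi\<^sup>2 * grid_sum M (\<lambda>(s, t). U (cos s, cos t))" if "M \<ge> N" for M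
    using outer(2) N[rule_format, OF that, symmetric] by (simp add: mult_left_mono)
  with outer(1) show ?thesis by blast
qed

text \<open>For x \<le> \<epsilon> the power of x is at most that of \<epsilon>; for x > \<epsilon>
  the factor \<open>x powr (r - q)\<close> is at most \<open>\<epsilon> powr (r - q)\<close>, since
  r \<le> q. This takes the place of Hoelder's inequality and leaves a bound that is polynomial in
  x.\<close>

lemma powr_le_interpolate:
  assumes "0 < \<epsilon>" "0 \<le> x" "1 \<le> r" "r \<le> real q"
  shows "(x + \<epsilon>) powr r \<le> 2 powr r * (\<epsilon> powr (r - real q) * x ^ q + 2 * \<epsilon> powr r)"
proof -
  have "x powr r \<le> \<epsilon> powr (r - real q) * x ^ q + \<epsilon> powr r"
  proof (cases "x \<le> \<epsilon>")
    case True
    then have "x powr r \<le> \<epsilon> powr r" using assms by (intro powr_mono2) auto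
    moreover have "0 \<le> \<epsilon> powr (r - real q) * x ^ q" using assms by simp
    ultimately show ?thesis by linarith
  next
    case False
    then have x: "x > 0" using assms by simp
    have "x powr r = x powr (r - real q) * x powr real q" by (simp add: powr_add[symmetric])
    also have "x powr (r - real q) \<le> \<epsilon> powr (r - real q)" using False assms by (intro powr_mono2') auto
    finally have "x powr r \<le> \<epsilon> powr (r - real q) * x ^ q" using x by (simp add: powr_realpow mult_right_mono)
    then show ?thesis by (smt (verit) powr_ge_zero)
  qed
  moreover have "(x + \<epsilon>) powr r \<le> 2 powr r * (x powr r + \<epsilon> powr r)"
  proof -
    have "(x + \<epsilon>) powr r \<le> (2 * max x \<epsilon>) powr r" using assms by (intro powr_mono2) auto
    also have "\<dots> = 2 powr r * max x \<epsilon> powr r" using assms by (intro powr_mult)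
    also have "max x \<epsilon> powr r \<le> x powr r + \<epsilon> powr r" by (simp add: max_def)
    finally show ?thesis by simp
  qed
  ultimately show ?thesis by (smt (verit) mult_left_mono powr_ge_zero)
qed

lemma cheb_norm_interpolation_error_le:
  assumes r: "1 \<le> r" and q: "q = 2 ^ Suc k" "r \<le> real q"
    and C: "C \<ge> 0" "\<And>n p P E M. node_lattice (n + p) n \<Longrightarrow> P \<in> Pi_L n p \<Longrightarrow> (\<forall>z\<in>LD n p. \<bar>P z\<bar> \<le> E) \<Longrightarrow>
     q * (2 * (n + p + n)) < M \<Longrightarrow> grid_sum M (\<lambda>(s, t). P (cos s, cos t) ^ q) \<le> C * real M ^ 2 * E ^ q"
    and nl: "node_lattice (n + p) n" and Q: "Q \<in> Pi_L n p" "\<And>z. z \<in> {-1..1} \<times> {-1..1} \<Longrightarrow> \<bar>f z - Q z\<bar> \<le> \<epsilon>"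
    and \<epsilon>: "\<epsilon> > 0"
  shows "cheb_norm r (\<lambda>z. lagrange_interpolant n p f z - f z) \<le> 2 * (C + 2) powr (1 / r) * \<epsilon>"
proof -
  define L where "L = lagrange_interpolant n p f"
  define P where "P z = L z + - Q z" for z
  have n: "n \<ge> 1" using nl by (simp add: node_lattice_def)
  have P: "P \<in> Pi_L n p" unfolding P_def L_def by (intro Pi_L_add Pi_L_uminus Q(1) lagrange_interpolant_interpolates(1) nl)
  have PLD: "\<forall>z\<in>LD n p. \<bar>P z\<bar> \<le> \<epsilon>"
  proof
    fix z assume z: "z \<in> LD n p"
    then have "z \<in> {-1..1} \<times> {-1..1}" by (auto simp: LD_eq_curve_points[OF n] curve_point_def)
    then show "\<bar>P z\<bar> \<le> \<epsilon>" using Q(2) lagrange_interpolant_interpolates(2)[OF nl z, of f] by (simp add: P_def L_def)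
  qed
  have qe: "even q" using q(1) by simp
  define U where "U z = 2 powr r * (\<epsilon> powr (r - real q) * P z ^ q + 2 * \<epsilon> powr r)" for z
  have U: "U \<in> cheb_poly" unfolding U_def
    by (intro cheb_poly_mult cheb_poly_add cheb_poly_const cheb_poly_power Pi_L_cheb_poly[OF P])
  have bd: "0 \<le> \<bar>L (x, y) - f (x, y)\<bar> powr r \<and> \<bar>L (x, y) - f (x, y)\<bar> powr r \<le> U (x, y)"
    if "x \<in> {-1..1}" "y \<in> {-1..1}" for x y
  proof -
    have "\<bar>f (x, y) - Q (x, y)\<bar> \<le> \<epsilon>" using Q(2) that by simp
    then have "\<bar>L (x, y) - f (x, y)\<bar> \<le> \<bar>P (x, y)\<bar> + \<epsilon>" unfolding P_def by linarith
    then have "\<bar>L (x, y) - f (x, y)\<bar> powr r \<le> (\<bar>P (x, y)\<bar> + \<epsilon>) powr r" using r by (intro powr_mono2) auto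
    also have "\<dots> \<le> U (x, y)"
      using powr_le_interpolate[OF \<epsilon> _ r q(2), of "\<bar>P (x, y)\<bar>"] qe by (simp add: U_def power_even_abs)
    finally show ?thesis by simp
  qed
  define I where "I = (LBINT y:{-1..1}. LBINT x:{-1..1}. \<bar>L (x, y) - f (x, y)\<bar> powr r / (sqrt (1 - x\<^sup>2) * sqrt (1 - y\<^sup>2)))"
  obtain N where N: "\<forall>M\<ge>N. 0 \<le> I \<and> real M ^ 2 * I \<le> pi\<^sup>2 * grid_sum M (\<lambda>(s, t). U (cos s, cos t))"
    using cheb_integral_le_grid_sum[OF U, of "\<lambda>z. \<bar>L z - f z\<bar> powr r"] bd unfolding I_def by blast
  \<comment> \<open>One grid that is fine enough both for the comparison with the integral of
    \<open>U\<close> and for the stability estimate.\<close>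
  define M where "M = Suc (max N (q * (2 * (n + p + n))))"
  have I0: "0 \<le> I" using N by blast
  have "M \<ge> N" by (simp add: M_def)
  then have "real M ^ 2 * I \<le> pi\<^sup>2 * grid_sum M (\<lambda>(s, t). U (cos s, cos t))" using N by blast
  also have "grid_sum M (\<lambda>(s, t). U (cos s, cos t)) =
      2 powr r * (\<epsilon> powr (r - real q) * grid_sum M (\<lambda>(s, t). P (cos s, cos t) ^ q) + real M ^ 2 * (2 * \<epsilon> powr r))"
    unfolding U_def case_prod_unfold grid_sum_cmult grid_sum_add grid_sum_const by (simp add: mult_ac)
  also have "\<dots> \<le> 2 powr r * (\<epsilon> powr (r - real q) * (C * real M ^ 2 * \<epsilon> ^ q) + real M ^ 2 * (2 * \<epsilon> powr r))"
    by (intro mult_left_mono add_right_mono C(2)[OF nl P PLD]) (auto simp: M_def)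
  \<comment> \<open>The scale \<epsilon> in the majorant is the bound for P on the nodes, so the
    powers combine to \<open>\<epsilon> powr r\<close> and the final error is linear in
    \<epsilon>.\<close>
  also have "\<epsilon> powr (r - real q) * (C * real M ^ 2 * \<epsilon> ^ q) = C * real M ^ 2 * \<epsilon> powr r"
    using \<epsilon> by (simp add: powr_diff powr_realpow)
  finally have "real M ^ 2 * I \<le> real M ^ 2 * (pi\<^sup>2 * (2 powr r * ((C + 2) * \<epsilon> powr r)))"
    by (simp add: algebra_simps mult_left_mono)
  then have "I \<le> pi\<^sup>2 * (2 powr r * ((C + 2) * \<epsilon> powr r))" by (simp add: M_def)
  then have "1 / pi\<^sup>2 * I \<le> 2 powr r * (C + 2) * \<epsilon> powr r" by (simp add: field_simps)
  then have "(1 / pi\<^sup>2 * I) powr (1 / r) \<le> (2 powr r * (C + 2) * \<epsilon> powr r) powr (1 / r)"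
    using I0 r by (intro powr_mono2) auto
  also have "\<dots> = 2 * (C + 2) powr (1 / r) * \<epsilon>"
    using \<epsilon> r C(1) by (simp add: powr_mult powr_powr)
  finally show ?thesis unfolding cheb_norm_def I_def L_def .
qed

theorem theorem10:
  fixes r :: real and f :: "real \<times> real \<Rightarrow> real" and p :: "nat \<Rightarrow> nat"
  assumes "1 \<le> r"
    and "continuous_on ({-1..1} \<times> {-1..1}) f"
    and "\<And>n. 1 \<le> n \<Longrightarrow> 1 \<le> p n"
    and "\<And>n. 1 \<le> n \<Longrightarrow> coprime n (n + p n)"
  shows "(\<lambda>n. cheb_norm r (\<lambda>z. lagrange_interpolant n (p n) f z - f z)) \<longlonglongrightarrow> 0"
proof (rule LIMSEQ_I)
  fix e :: real assume e: "e > 0"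
  obtain k :: nat where "r < 2 ^ k" using real_arch_pow[of 2 r] by auto
  define q :: nat where "q = 2 ^ Suc k"
  have q: "r \<le> real q" using \<open>r < 2 ^ k\<close> assms(1) by (simp add: q_def)
  obtain C where C: "C \<ge> 0" "\<And>n p P E M. node_lattice (n + p) n \<Longrightarrow> P \<in> Pi_L n p \<Longrightarrow> (\<forall>z\<in>LD n p. \<bar>P z\<bar> \<le> E) \<Longrightarrow>
     q * (2 * (n + p + n)) < M \<Longrightarrow> grid_sum M (\<lambda>(s, t). P (cos s, cos t) ^ q) \<le> C * real M ^ 2 * E ^ q"
    using Pi_L_norm_bound[of k] unfolding q_def by blast
  \<comment> \<open>The constant is fixed by r and the choice of q alone, so the accuracy \<epsilon>
    and the polynomial approximating f can be chosen after it.\<close>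
  define D where "D = 2 * (C + 2) powr (1 / r)"
  have D: "D > 0" using C(1) by (simp add: D_def)
  define \<epsilon> where "\<epsilon> = e / (2 * D)"
  have \<epsilon>: "\<epsilon> > 0" using e D by (simp add: \<epsilon>_def)
  obtain g where g: "real_polynomial_function g" "\<And>z. z \<in> {-1..1} \<times> {-1..1} \<Longrightarrow> \<bar>f z - g z\<bar> < \<epsilon>"
    using Stone_Weierstrass_real_polynomial_function[OF _ assms(2) \<epsilon>] by (metis compact_Icc compact_Times)
  obtain Q where Q: "Q \<in> cheb_poly" "\<forall>z\<in>{-1..1} \<times> {-1..1}. g z = Q z" using polynomial_cheb_poly[OF g(1)] by blast
  obtain N where N: "\<forall>n\<ge>N. \<forall>p. Q \<in> Pi_L n p" using cheb_poly_eventually_Pi_L[OF Q(1)] by blast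
  have "norm (cheb_norm r (\<lambda>z. lagrange_interpolant n (p n) f z - f z) - 0) < e" if "n \<ge> max 1 N" for n
  proof -
    have nl: "node_lattice (n + p n) n" using assms(4)[of n] that by (intro node_lattice_nat) auto
    have Qn: "Q \<in> Pi_L n (p n)" using N that by simp
    have fQ: "\<bar>f z - Q z\<bar> \<le> \<epsilon>" if "z \<in> {-1..1} \<times> {-1..1}" for z
      using g(2)[OF that] Q(2) that by (auto intro: less_imp_le)
    have "cheb_norm r (\<lambda>z. lagrange_interpolant n (p n) f z - f z) \<le> D * \<epsilon>"
      unfolding D_def by (rule cheb_norm_interpolation_error_le[OF assms(1) q_def q C nl Qn fQ \<epsilon>])
    also have "\<dots> < e" using D e by (simp add: \<epsilon>_def)
    finally show ?thesis by (simp add: cheb_norm_def)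
  qed
  then show "\<exists>N. \<forall>n\<ge>N. norm (cheb_norm r (\<lambda>z. lagrange_interpolant n (p n) f z - f z) - 0) < e" by blast
qed

end
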